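(* Let $k\ge 2$ be an integer, let $T$ be the infinite rooted $k$-ary tree, let $p>1$ and let $w$ be a weight on $T$. Assume that there exist real numbers $0<\beta<1$ and $\beta\le\alpha<p$ such that, for all finite sets $E,F\subset T$ and all integers $r\ge 0$, $$\sum_{x\in E}\ \sum_{\substack{y\in F\\ d(x,y)=r}} w(y)\ \lesssim\ k^{r\beta}\,w(E)^{\frac{\alpha}{p}}\,w(F)^{1-\frac{\alpha}{p}}.$$ Then for all functions $f$ on $T$ $$\|Mf\|_{L^{\frac{\beta}{\alpha}p,\infty}(w)}\lesssim\|f\|_{L^{\frac{\beta}{\alpha}p}(w)}.$$ Furthermore, if $\beta<\alpha$, then for all functions $f$ on $T$ $$\|Mf\|_{L^{p}(w)}\lesssim\|f\|_{L^{p}(w)}\qquad\text{and}\qquad \|Mf\|_{L^{p'}(\sigma_{p})}\lesssim\|f\|_{L^{p'}(\sigma_{p})},$$ where $\sigma_p=w^{-\frac{1}{p-1}}$ and $p'=\frac{p}{p-1}$.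
   Context: For an integer $k\ge2$, $T$ denotes (the vertex set of) the infinite rooted $k$-ary tree, in which every vertex has exactly $k$ children; $d(x,y)$ is the number of edges on the unique path between $x$ and $y$. $T$ carries the counting measure: $|A|$ is the cardinality of $A$. $B(x,r)=\{y\in T: d(x,y)\le r\}$. The centered maximal function is $Mf(x)=\sup_{r\in\mathbb{N}\cup\{0\}}\frac{1}{|B(x,r)|}\sum_{y\in B(x,r)}|f(y)|$. A weight is a function $w:T\to(0,\infty)$, and $w(A)=\sum_{x\in A}w(x)$ for $A\subset T$. For $0<q<\infty$, $\|f\|_{L^q(w)}=\left(\sum_{x\in T}|f(x)|^q w(x)\right)^{1/q}$ and $\|f\|_{L^{q,\infty}(w)}=\sup_{\lambda>0}\lambda\, w(\{x\in T:|f(x)|>\lambda\})^{1/q}$. The notation $A\lesssim B$ means $A\le CB$ for a finite constant $C$ independent of the varying objects (in the hypothesis: of $E,F,r$; in the conclusions: of $f$). *)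

theory Defs
  imports "HOL-Analysis.Analysis" "HOL-Library.Sublist"
begin

section \<open>The infinite rooted k-ary tree\<close>

text \<open>
  A vertex is the list of the child indices met on the way from the vertex up to the root,
  so the root is the empty list and the \<open>k\<close> children of \<open>x\<close> are \<open>i # x\<close> for \<open>i < k\<close>.
\<close>

definition kary_tree :: "nat \<Rightarrow> nat list set" where
  "kary_tree k = lists {..<k}"

definition tree_adj :: "nat list \<Rightarrow> nat list \<Rightarrow> bool" where
  "tree_adj x y \<longleftrightarrow> (\<exists>i. y = i # x \<or> x = i # y)"

definition tree_path :: "nat \<Rightarrow> nat list \<Rightarrow> nat list \<Rightarrow> nat list list \<Rightarrow> bool" where
  "tree_path k x y p \<longleftrightarrow>
     p \<noteq> [] \<and> hd p = x \<and> last p = y \<and> set p \<subseteq> kary_tree k \<and> distinct p \<and> successively tree_adj p"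

definition tree_dist :: "nat \<Rightarrow> nat list \<Rightarrow> nat list \<Rightarrow> nat" where
  "tree_dist k x y = length (THE p. tree_path k x y p) - 1"

text \<open>The path in the definition of the distance exists and is unique.\<close>

lemma stays_in_subtree:
  assumes "successively tree_adj p" "p \<noteq> []" "z \<noteq> []" "suffix z (hd p)" "tl z \<notin> set p" "v \<in> set p"
  shows "suffix z v"
  using assms
proof (induction p arbitrary: v)
  case (Cons u q)
  show ?case
  proof (cases q)
    case Nil
    then show ?thesis using Cons.prems by simp
  next
    case (Cons u' q')
    have "suffix z u'"
      using Cons.prems Cons unfolding tree_adj_def by (auto simp: suffix_Cons)
    then show ?thesis using Cons.IH[of v] Cons.prems Cons by auto
  qed
qed simp

lemma stays_out_of_subtree:
  assumes "successively tree_adj p" "p \<noteq> []" "\<not> suffix z (hd p)" "z \<notin> set p" "v \<in> set p"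
  shows "\<not> suffix z v"
  using assms
proof (induction p arbitrary: v)
  case (Cons u q)
  show ?case
  proof (cases q)
    case Nil
    then show ?thesis using Cons.prems by simp
  next
    case (Cons u' q')
    have "\<not> suffix z u'"
      using Cons.prems Cons unfolding tree_adj_def by (auto simp: suffix_Cons)
    then show ?thesis using Cons.IH[of v] Cons.prems Cons by auto
  qed
qed simp

lemma tree_path_step:
  assumes "tree_path k x y (x # v # q)"
  shows "(if suffix x y then \<exists>i. v = i # x \<and> suffix (i # x) y else v = tl x)"
proof -
  have P: "successively tree_adj (v # q)" "x \<notin> set (v # q)" "y \<in> set (v # q)" "tree_adj x v"
    using assms by (auto simp: tree_path_def split: if_splits)
  from P(4) consider i where "v = i # x" | i where "x = i # v"
    unfolding tree_adj_def by auto
  then show ?thesis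
  proof cases
    case 1
    then have "suffix (i # x) y"
      using stays_in_subtree[OF P(1), of "i # x" y] P by simp
    then show ?thesis using 1 by (auto dest: suffix_ConsD)
  next
    case 2
    then have "\<not> suffix x v" by (auto simp: suffix_def)
    then have "\<not> suffix x y"
      using stays_out_of_subtree[OF P(1), of x y] P by simp
    then show ?thesis using 2 by simp
  qed
qed

lemma tree_path_unique:
  assumes "tree_path k x y p" "tree_path k x y p'"
  shows "p = p'"
  using assms
proof (induction p arbitrary: x p')
  case Nil
  then show ?case by (simp add: tree_path_def)
next
  case (Cons u q)
  from Cons.prems obtain q' where p': "p' = x # q'" and u: "u = x"
    by (cases p') (auto simp: tree_path_def)
  show ?case
  proof (cases "x = y")
    case True
    then have "q = []" "q' = []"
      using Cons.prems p' u by (auto simp: tree_path_def split: if_splits)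
    then show ?thesis using p' u by simp
  next
    case False
    then obtain v r v' r' where q: "q = v # r" "q' = v' # r'"
      using Cons.prems p' u by (cases q; cases q') (auto simp: tree_path_def)
    have "v = v'"
      using tree_path_step[of k x y v r] tree_path_step[of k x y v' r'] Cons.prems p' u q
      by (auto simp: suffix_def split: if_splits)
    moreover have "tree_path k v y q" "tree_path k v' y q'"
      using Cons.prems p' u q by (auto simp: tree_path_def)
    ultimately show ?thesis using Cons.IH[of v q'] p' u by simp
  qed
qed

lemma tree_path_extend:
  assumes "tree_path k v y q" "tree_adj x v" "x \<in> kary_tree k"
  shows "\<exists>p. tree_path k x y p"
proof (cases "x \<in> set q")
  case True
  then obtain a b where "q = a @ x # b" by (auto dest: split_list)
  then have "tree_path k x y (x # b)"
    using assms by (auto simp: tree_path_def successively_append_iff)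
  then show ?thesis ..
next
  case False
  then have "tree_path k x y (x # q)"
    using assms by (auto simp: tree_path_def successively_Cons)
  then show ?thesis ..
qed

lemma tree_path_exists:
  assumes "x \<in> kary_tree k" "y \<in> kary_tree k"
  shows "\<exists>p. tree_path k x y p"
proof -
  have up: "\<exists>p. tree_path k x y p" if "\<exists>p. tree_path k [] y p" "x \<in> kary_tree k" for x y
    using that(2)
  proof (induction x)
    case (Cons a x)
    then obtain p where "tree_path k x y p" by (auto simp: kary_tree_def)
    then show ?case
      by (rule tree_path_extend) (use Cons.prems in \<open>auto simp: tree_adj_def\<close>)
  qed (use that in simp)
  have "tree_path k [] [] [[]]" by (simp add: tree_path_def kary_tree_def)
  then obtain p where "tree_path k y [] p" using up assms(2) by blast
  moreover have "tree_adj u v = tree_adj v u" for u v by (auto simp: tree_adj_def)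
  ultimately have "tree_path k [] y (rev p)"
    by (simp add: tree_path_def hd_rev last_rev)
  then show ?thesis using up assms(1) by blast
qed

lemma tree_path_ex1:
  assumes "x \<in> kary_tree k" "y \<in> kary_tree k"
  shows "\<exists>!p. tree_path k x y p"
  using tree_path_exists[OF assms] tree_path_unique by blast

definition tree_ball :: "nat \<Rightarrow> nat list \<Rightarrow> nat \<Rightarrow> nat list set" where
  "tree_ball k x r = {y \<in> kary_tree k. tree_dist k x y \<le> r}"

section \<open>Maximal function and weighted norms\<close>

text \<open>The supremum and the weighted sums may be infinite, so they are taken in \<^typ>\<open>ennreal\<close>.\<close>

definition maximal_fun :: "nat \<Rightarrow> (nat list \<Rightarrow> complex) \<Rightarrow> nat list \<Rightarrow> ennreal" where
  "maximal_fun k f x =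
     (SUP r. ennreal ((\<Sum>y\<in>tree_ball k x r. cmod (f y)) / real (card (tree_ball k x r))))"

text \<open>The power with a positive real exponent on \<open>[0, \<infinity>]\<close>; it is only used for \<open>a > 0\<close>.\<close>

definition enn_powr :: "ennreal \<Rightarrow> real \<Rightarrow> ennreal" where
  "enn_powr t a = (if t = \<infinity> then \<infinity> else ennreal (enn2real t powr a))"

definition tree_weight :: "nat \<Rightarrow> (nat list \<Rightarrow> real) \<Rightarrow> bool" where
  "tree_weight k w \<longleftrightarrow> (\<forall>x\<in>kary_tree k. w x > 0)"

definition dual_weight :: "real \<Rightarrow> (nat list \<Rightarrow> real) \<Rightarrow> nat list \<Rightarrow> real" where
  "dual_weight p w x = w x powr (- (1 / (p - 1)))"

definition weight_of :: "(nat list \<Rightarrow> real) \<Rightarrow> nat list set \<Rightarrow> ennreal" where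
  "weight_of w A = (\<integral>\<^sup>+x. ennreal (w x) \<partial>count_space A)"

text \<open>
  The norms take the modulus as an \<^typ>\<open>ennreal\<close>-valued function \<open>g\<close>:
  \<open>g x = \<bar>f x\<bar>\<close> for a function \<open>f\<close>, and \<open>g = Mf\<close> for the maximal function.
\<close>

definition Lnorm :: "nat \<Rightarrow> real \<Rightarrow> (nat list \<Rightarrow> real) \<Rightarrow> (nat list \<Rightarrow> ennreal) \<Rightarrow> ennreal" where
  "Lnorm k q w g =
     enn_powr (\<integral>\<^sup>+x. enn_powr (g x) q * ennreal (w x) \<partial>count_space (kary_tree k)) (1 / q)"

definition weak_Lnorm :: "nat \<Rightarrow> real \<Rightarrow> (nat list \<Rightarrow> real) \<Rightarrow> (nat list \<Rightarrow> ennreal) \<Rightarrow> ennreal" where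
  "weak_Lnorm k q w g =
     (SUP l\<in>{0::real<..}. ennreal l * enn_powr (weight_of w {x \<in> kary_tree k. g x > ennreal l}) (1 / q))"

end

theory Submission
  imports Defs
begin

text \<open>
  Only the exponential growth of spheres matters for the analysis. For the weak bound, sort the
  values of \<open>f / \<lambda>\<close> into \<open>k\<close>-adic level sets \<open>E\<^sub>n\<close>. If the average over a ball around \<open>y\<close> exceeds
  \<open>\<lambda>\<close>, then for some radius \<open>r\<close> and some \<open>n\<close> the sphere of radius \<open>r\<close> meets \<open>E\<^sub>n\<close> in many points:
  at least one if \<open>n > r\<close>, and about \<open>k\<^bsup>(1 - \<gamma>)(r - n)\<^esup>\<close> if \<open>n \<le> r\<close>, where \<open>0 < \<gamma> < 1 - \<beta>\<close>. The
  hypothesis with \<open>E = E\<^sub>n\<close> and \<open>F\<close> the set of these \<open>y\<close> bounds \<open>w(F)\<close> by \<open>k\<^bsup>nq\<^esup> w(E\<^sub>n)\<close> with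
  \<open>q = \<beta> p / \<alpha>\<close>, up to a factor decaying geometrically in \<open>|r - n|\<close>.

  If \<open>\<beta> < \<alpha>\<close>, applying the hypothesis to the points at distance \<open>r\<close> from \<open>E\<close> and interpolating with
  the trivial bound gives analogous estimates with exponents \<open>1 / p + \<delta>\<close> and \<open>1 / p - \<delta>\<close> and with
  growth \<open>k\<^bsup>rb\<^esup>\<close>, \<open>b < 1\<close>. Decomposing both functions into level sets, they yield the bilinear bound
  \<open>\<Sum> k\<^bsup>-d(x,y)\<^esup> f(x) g(y) w(y) \<lesssim> \<Sum> f\<^sup>p w + \<Sum> g\<^bsup>p'\<^esup> w\<close>. As \<open>Mf\<close> is dominated by the operator with
  the symmetric kernel \<open>k\<^bsup>-d(x,y)\<^esup>\<close>, both strong bounds follow by duality.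
\<close>

section \<open>Geometric sums and elementary inequalities for sums and powers\<close>

lemma sum_power_inj_le:
  fixes \<rho> :: real
  assumes "0 \<le> \<rho>" "\<rho> < 1" "finite J" "inj_on h J"
  shows "(\<Sum>j\<in>J. \<rho> ^ h j) \<le> 1 / (1 - \<rho>)"
proof -
  have "(\<Sum>j\<in>J. \<rho> ^ h j) = (\<Sum>n\<in>h ` J. \<rho> ^ n)"
    using assms by (simp add: sum.reindex)
  also have "\<dots> \<le> (\<Sum>n. \<rho> ^ n)"
    using assms by (intro sum_le_suminf) (auto intro: summable_geometric)
  also have "\<dots> = 1 / (1 - \<rho>)"
    using assms by (intro suminf_geometric) auto
  finally show ?thesis .
qed

text \<open>The integers on each side of \<open>t\<close> are numbered by their distance from the
  floor of \<open>t\<close>, giving two geometric series. The bound is uniform in \<open>t\<close>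
  and \<open>J\<close>; this is what lets double sums over levels and radii collapse to single
  ones.\<close>

lemma sum_powr_dist_le:
  fixes K \<epsilon> t :: real and J :: "int set"
  assumes "K > 1" "\<epsilon> > 0" "finite J"
  shows "(\<Sum>j\<in>J. K powr (- \<epsilon> * \<bar>of_int j - t\<bar>)) \<le> 2 / (1 - K powr (- \<epsilon>))"
proof -
  define \<rho> where "\<rho> = K powr (- \<epsilon>)"
  define m where "m = \<lfloor>t\<rfloor>"
  have \<rho>: "0 < \<rho>" "\<rho> < 1"
    using assms by (auto simp: \<rho>_def powr_less_one)
  have pow: "\<rho> ^ n = K powr (- \<epsilon> * real n)" for n
    using assms by (simp add: \<rho>_def powr_realpow[symmetric] powr_powr)
  have m: "of_int m \<le> t" "t < of_int m + 1"
    by (auto simp: m_def)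
  have "(\<Sum>j\<in>J. K powr (- \<epsilon> * \<bar>of_int j - t\<bar>))
      = (\<Sum>j\<in>{j\<in>J. j \<le> m}. K powr (- \<epsilon> * \<bar>of_int j - t\<bar>))
        + (\<Sum>j\<in>{j\<in>J. j > m}. K powr (- \<epsilon> * \<bar>of_int j - t\<bar>))"
    using assms by (subst sum.union_disjoint[symmetric]) (auto intro!: sum.cong)
  also have "\<dots> \<le> (\<Sum>j\<in>{j\<in>J. j \<le> m}. \<rho> ^ nat (m - j)) + (\<Sum>j\<in>{j\<in>J. j > m}. \<rho> ^ nat (j - m - 1))"
  proof (intro add_mono sum_mono)
    fix j assume "j \<in> {j\<in>J. j \<le> m}"
    then have j: "real_of_int j \<le> real_of_int m" "j \<le> m" by auto
    then have "real (nat (m - j)) \<le> \<bar>of_int j - t\<bar>" using m by simp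
    then show "K powr (- \<epsilon> * \<bar>of_int j - t\<bar>) \<le> \<rho> ^ nat (m - j)"
      unfolding pow using assms by (intro powr_mono) auto
  next
    \<comment> \<open>On this side \<open>m + 1\<close> may lie arbitrarily close to
      \<open>t\<close>, so the powers are numbered from \<open>j - m - 1 = 0\<close>.\<close>
    fix j assume "j \<in> {j\<in>J. j > m}"
    then have j: "m + 1 \<le> j" by auto
    then have "real_of_int m + 1 \<le> real_of_int j" by linarith
    then have "real (nat (j - m - 1)) \<le> \<bar>of_int j - t\<bar>" using m j by simp
    then show "K powr (- \<epsilon> * \<bar>of_int j - t\<bar>) \<le> \<rho> ^ nat (j - m - 1)"
      unfolding pow using assms by (intro powr_mono) auto
  qed
  also have "\<dots> \<le> 1 / (1 - \<rho>) + 1 / (1 - \<rho>)"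
    using \<rho> assms by (intro add_mono sum_power_inj_le) (auto simp: inj_on_def)
  finally show ?thesis by (simp add: \<rho>_def)
qed

lemma sum_powr_dist_nat_le:
  fixes K \<epsilon> t :: real and J :: "nat set"
  assumes "K > 1" "\<epsilon> > 0" "finite J"
  shows "(\<Sum>j\<in>J. K powr (- \<epsilon> * \<bar>real j - t\<bar>)) \<le> 2 / (1 - K powr (- \<epsilon>))"
  using sum_powr_dist_le[of K \<epsilon> "int ` J" t] assms by (simp add: sum.reindex)

lemma sum_UN_le:
  fixes g :: "'a \<Rightarrow> real"
  assumes "finite I" "\<And>i. i \<in> I \<Longrightarrow> finite (A i)" "\<And>i x. i \<in> I \<Longrightarrow> x \<in> A i \<Longrightarrow> 0 \<le> g x"
  shows "sum g (\<Union>i\<in>I. A i) \<le> (\<Sum>i\<in>I. sum g (A i))"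
  using assms
proof (induction I rule: finite_induct)
  case (insert i I)
  have "sum g (A i \<union> (\<Union>i\<in>I. A i)) + sum g (A i \<inter> (\<Union>i\<in>I. A i)) = sum g (A i) + sum g (\<Union>i\<in>I. A i)"
    using insert by (intro sum.union_inter) auto
  moreover have "0 \<le> sum g (A i \<inter> (\<Union>i\<in>I. A i))"
    using insert by (intro sum_nonneg) auto
  moreover have "sum g (\<Union>i\<in>I. A i) \<le> (\<Sum>i\<in>I. sum g (A i))"
    using insert by auto
  ultimately show ?case using insert by simp
qed simp

text \<open>Replacing both bases by \<open>max P Q\<close> makes the exponents add up to 1. This
  crude form of weighted AM-GM loses only a constant.\<close>

lemma powr_mult_powr_le_add:
  fixes P Q a :: real
  assumes "P \<ge> 0" "Q \<ge> 0" "0 \<le> a" "a \<le> 1"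
  shows "P powr a * Q powr (1 - a) \<le> P + Q"
proof (cases "P = 0 \<or> Q = 0")
  case False
  then have "P powr a * Q powr (1 - a) \<le> max P Q powr a * max P Q powr (1 - a)"
    using assms by (intro mult_mono powr_mono2) auto
  also have "\<dots> = max P Q"
    using assms False by (simp flip: powr_add)
  finally show ?thesis using assms by linarith
qed (use assms in auto)

section \<open>Decomposition into level sets\<close>

lemma powr_floor_log_bounds:
  assumes "K > 1" "t > 0"
  shows "K powr of_int \<lfloor>log K t\<rfloor> \<le> t" "t < K powr (of_int \<lfloor>log K t\<rfloor> + 1)"
proof -
  have "K powr of_int \<lfloor>log K t\<rfloor> \<le> K powr log K t"
    using assms by (intro powr_mono) auto
  then show "K powr of_int \<lfloor>log K t\<rfloor> \<le> t" using assms by simp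
  have "K powr log K t < K powr (of_int \<lfloor>log K t\<rfloor> + 1)"
    using assms by (intro powr_less_mono) auto
  then show "t < K powr (of_int \<lfloor>log K t\<rfloor> + 1)" using assms by simp
qed

text \<open>Since spheres have at most \<open>4 K ^ r\<close> points, the values of \<open>f\<close> below \<open>1 / 8\<close> contribute at
  most half of a sphere sum exceeding \<open>K ^ r\<close>; the remaining values are sorted by powers of \<open>K\<close>.\<close>

definition level_set :: "real \<Rightarrow> ('a \<Rightarrow> real) \<Rightarrow> 'a set \<Rightarrow> nat \<Rightarrow> 'a set" where
  "level_set K f X n = {x \<in> X. K powr real n \<le> 8 * f x \<and> 8 * f x < K powr (real n + 1)}"

lemma level_set_cover:
  assumes "K > 1" "1 \<le> 8 * f x" "x \<in> X"
  shows "x \<in> level_set K f X (nat \<lfloor>log K (8 * f x)\<rfloor>)"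
proof -
  have "0 \<le> log K (8 * f x)" using assms by simp
  then have "real (nat \<lfloor>log K (8 * f x)\<rfloor>) = of_int \<lfloor>log K (8 * f x)\<rfloor>" by simp
  then show ?thesis
    using powr_floor_log_bounds[of K "8 * f x"] assms by (simp add: level_set_def)
qed

lemma level_set_unique:
  assumes "K > 1" "x \<in> level_set K f X n"
  shows "n = nat \<lfloor>log K (8 * f x)\<rfloor>"
proof -
  have "0 < K powr real n" using assms by simp
  also have "\<dots> \<le> 8 * f x" using assms by (simp add: level_set_def)
  finally have pos: "0 < 8 * f x" .
  have "real n \<le> log K (8 * f x)" "log K (8 * f x) < real n + 1"
    using assms pos by (auto simp: level_set_def le_log_iff log_less_iff)
  then have "\<lfloor>log K (8 * f x)\<rfloor> = int n" by (intro floor_unique) auto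
  then show ?thesis by simp
qed

lemma level_set_disjoint:
  assumes "K > 1" "n \<noteq> m"
  shows "level_set K f X n \<inter> level_set K f X m = {}"
proof (rule ccontr)
  assume "\<not> ?thesis"
  then obtain x where "x \<in> level_set K f X n" "x \<in> level_set K f X m" by blast
  then show False using level_set_unique[OF \<open>K > 1\<close>, of x f X] assms(2) by metis
qed

text \<open>If every nonempty level stayed below its threshold, the values at least
  \<open>1 / 8\<close> would contribute at most \<open>K ^ r / 2\<close>, and so do the smaller
  values. The factor \<open>K powr (- \<gamma> * \<bar>real n - real r\<bar>)\<close> makes the
  allotments to the levels summable.\<close>

lemma level_set_pigeonhole:
  fixes K \<gamma> :: real and f :: "'a \<Rightarrow> real"
  assumes K: "K > 1" and \<gamma>: "\<gamma> > 0" and S: "finite S" "real (card S) \<le> 4 * K ^ r"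
    and f: "K ^ r < sum f S"
  shows "\<exists>n. level_set K f S n \<noteq> {} \<and>
    2 * (1 - K powr (- \<gamma>)) / K * K powr (real r - real n - \<gamma> * \<bar>real n - real r\<bar>)
      \<le> real (card (level_set K f S n))"
proof (rule ccontr)
  assume neg: "\<not> ?thesis"
  \<comment> \<open>The constant is chosen so that the bound for the geometric series over the
    levels comes out as exactly \<open>K ^ r / 2\<close>.\<close>
  define c where "c = 2 * (1 - K powr (- \<gamma>)) / K"
  define N where "N = (\<lambda>x. nat \<lfloor>log K (8 * f x)\<rfloor>) ` {x \<in> S. 1 \<le> 8 * f x}"
  let ?L = "level_set K f S"
  have \<rho>: "K powr (- \<gamma>) < 1" using K \<gamma> by (simp add: powr_less_one)
  have c: "c > 0" using K \<rho> by (simp add: c_def)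
  have fN: "finite N" using S by (simp add: N_def)
  have fL: "finite (?L n)" for n using S by (simp add: level_set_def)
  have card_L: "real (card (?L n)) \<le> c * K powr (real r - real n - \<gamma> * \<bar>real n - real r\<bar>)" for n
  proof (cases "?L n = {}")
    case False
    with neg show ?thesis by (auto simp: c_def intro: less_imp_le)
  qed (use c in simp)
  have "sum f S = sum f {x \<in> S. \<not> 1 \<le> 8 * f x} + sum f {x \<in> S. 1 \<le> 8 * f x}"
    using S by (subst sum.union_disjoint[symmetric]) (auto intro!: sum.cong)
  also have "sum f {x \<in> S. \<not> 1 \<le> 8 * f x} \<le> real (card S) * (1 / 8)"
  proof -
    have "sum f {x \<in> S. \<not> 1 \<le> 8 * f x} \<le> (\<Sum>x\<in>{x \<in> S. \<not> 1 \<le> 8 * f x}. 1 / 8)"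
      by (intro sum_mono) auto
    also have "\<dots> \<le> (\<Sum>x\<in>S. 1 / 8)"
      using S by (intro sum_mono2) auto
    finally show ?thesis by simp
  qed
  also have "real (card S) * (1 / 8) \<le> K ^ r / 2" using S by simp
  also have "sum f {x \<in> S. 1 \<le> 8 * f x} \<le> K ^ r / 2"
  proof -
    have "{x \<in> S. 1 \<le> 8 * f x} = (\<Union>n\<in>N. ?L n)"
    proof (intro equalityI subsetI)
      fix x assume "x \<in> {x \<in> S. 1 \<le> 8 * f x}"
      then show "x \<in> (\<Union>n\<in>N. ?L n)"
        using level_set_cover[of K f x S] K by (auto simp: N_def)
    next
      fix x assume "x \<in> (\<Union>n\<in>N. ?L n)"
      then obtain n where n: "x \<in> ?L n" by auto
      have "1 \<le> K powr real n" using K by (intro ge_one_powr_ge_zero) auto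
      then show "x \<in> {x \<in> S. 1 \<le> 8 * f x}" using n by (auto simp: level_set_def)
    qed
    then have "sum f {x \<in> S. 1 \<le> 8 * f x} = (\<Sum>n\<in>N. sum f (?L n))"
      using fN fL level_set_disjoint[OF K, of _ _ f S]
      by (simp only:) (intro sum.UNION_disjoint, auto)
    also have "\<dots> \<le> (\<Sum>n\<in>N. (K powr (real n + 1) / 8) * real (card (?L n)))"
    proof (rule sum_mono)
      fix n
      have "sum f (?L n) \<le> (\<Sum>x\<in>?L n. K powr (real n + 1) / 8)"
        by (intro sum_mono) (auto simp: level_set_def)
      then show "sum f (?L n) \<le> (K powr (real n + 1) / 8) * real (card (?L n))"
        by (simp add: mult.commute)
    qed
    also have "\<dots> \<le> (\<Sum>n\<in>N. (K powr (real n + 1) / 8) *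
        (c * K powr (real r - real n - \<gamma> * \<bar>real n - real r\<bar>)))"
      by (intro sum_mono mult_left_mono card_L) auto
    also have "\<dots> = (\<Sum>n\<in>N. c * K / 8 * K ^ r * K powr (- \<gamma> * \<bar>real n - real r\<bar>))"
    proof (rule sum.cong)
      fix n
      have "K powr (real n + 1) * K powr (real r - real n - \<gamma> * \<bar>real n - real r\<bar>)
          = K powr (1 + real r + - \<gamma> * \<bar>real n - real r\<bar>)"
        by (simp add: powr_add[symmetric] algebra_simps)
      also have "\<dots> = K * K ^ r * K powr (- \<gamma> * \<bar>real n - real r\<bar>)"
        using K by (simp only: powr_add) (simp add: powr_realpow)
      finally show "(K powr (real n + 1) / 8) * (c * K powr (real r - real n - \<gamma> * \<bar>real n - real r\<bar>))
          = c * K / 8 * K ^ r * K powr (- \<gamma> * \<bar>real n - real r\<bar>)"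
        by (simp add: field_simps)
    qed simp
    also have "\<dots> \<le> c * K / 8 * K ^ r * (2 / (1 - K powr (- \<gamma>)))"
      unfolding sum_distrib_left[symmetric] using c K \<gamma> fN
      by (intro mult_left_mono sum_powr_dist_nat_le) auto
    also have "\<dots> = K ^ r / 2"
    proof -
      have "2 * u / K * K / 8 * K ^ r * (2 / u) = K ^ r / 2" if "u \<noteq> 0" for u
        using that K by simp
      from this[of "1 - K powr (- \<gamma>)"] show ?thesis using \<rho> by (simp only: c_def)
    qed
    finally show ?thesis .
  qed
  finally show False using f by simp
qed

section \<open>Estimates over spheres\<close>

text \<open>Spheres are centred at the second argument of \<open>d\<close>; symmetry of
  \<open>d\<close> is an explicit assumption where duality uses it. The constant \<open>4\<close> is
  the one that \<open>card_tree_ball_le\<close> provides for the tree.\<close>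

locale sphere_weight =
  fixes V :: "'a set" and d :: "'a \<Rightarrow> 'a \<Rightarrow> nat" and w :: "'a \<Rightarrow> real" and K :: real
  assumes K: "K > 1"
    and w_pos: "x \<in> V \<Longrightarrow> w x > 0"
    and finite_sphere: "y \<in> V \<Longrightarrow> finite {x \<in> V. d x y = r}"
    and card_sphere: "y \<in> V \<Longrightarrow> real (card {x \<in> V. d x y = r}) \<le> 4 * K ^ r"
begin

definition sphere_sum :: "nat \<Rightarrow> 'a set \<Rightarrow> 'a set \<Rightarrow> real" where
  "sphere_sum r E F = (\<Sum>x\<in>E. \<Sum>y\<in>{y \<in> F. d x y = r}. w y)"

text \<open>The hypothesis of the theorem is the case \<open>a = \<alpha> / p\<close>,
  \<open>b = \<beta>\<close>. Keeping both exponents as parameters allows the estimate to be moved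
  to other pairs.\<close>

definition sphere_estimate :: "real \<Rightarrow> real \<Rightarrow> real \<Rightarrow> bool" where
  "sphere_estimate a b C \<longleftrightarrow> (\<forall>E F. \<forall>r::nat. finite E \<and> E \<subseteq> V \<and> finite F \<and> F \<subseteq> V \<longrightarrow>
     sphere_sum r E F \<le> C * K powr (real r * b) * sum w E powr a * sum w F powr (1 - a))"

lemma sum_w_nonneg: "A \<subseteq> V \<Longrightarrow> sum w A \<ge> 0"
  by (intro sum_nonneg) (auto intro: less_imp_le w_pos)

lemma sum_w_pos: "finite A \<Longrightarrow> A \<subseteq> V \<Longrightarrow> A \<noteq> {} \<Longrightarrow> sum w A > 0"
  by (intro sum_pos) (auto intro: w_pos)

lemma sum_w_mono: "finite B \<Longrightarrow> A \<subseteq> B \<Longrightarrow> B \<subseteq> V \<Longrightarrow> sum w A \<le> sum w B"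
  by (intro sum_mono2) (auto intro: less_imp_le w_pos)

text \<open>Exchanging the sums shows the operator behind the bilinear form: it counts the points of
  \<open>E\<close> on the sphere around \<open>y\<close>.\<close>

lemma sphere_sum_eq:
  assumes "finite E" "finite F"
  shows "sphere_sum r E F = (\<Sum>y\<in>F. w y * real (card {x \<in> E. d x y = r}))"
proof -
  have "sphere_sum r E F = (\<Sum>x\<in>E. \<Sum>y\<in>F. if d x y = r then w y else 0)"
    unfolding sphere_sum_def
    by (rule sum.cong) (simp_all add: sum.inter_filter assms)
  also have "\<dots> = (\<Sum>y\<in>F. \<Sum>x\<in>E. if d x y = r then w y else 0)"
    by (rule sum.swap)
  also have "\<dots> = (\<Sum>y\<in>F. w y * real (card {x \<in> E. d x y = r}))"
    using assms by (intro sum.cong refl) (simp add: sum.inter_filter[symmetric])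
  finally show ?thesis .
qed

lemma sphere_estimateD:
  assumes "sphere_estimate a b C" "finite E" "E \<subseteq> V" "finite F" "F \<subseteq> V"
  shows "sphere_sum r E F \<le> C * K powr (real r * b) * sum w E powr a * sum w F powr (1 - a)"
  using assms by (auto simp: sphere_estimate_def)

text \<open>Chebyshev's inequality bounds \<open>\<tau> * sum w G\<close> by the sphere sum of
  \<open>E\<close> and \<open>G\<close>. The estimate then puts \<open>sum w G powr (1 - a)\<close>
  on the right, and for nonempty \<open>G\<close> this positive factor cancels.\<close>

lemma superlevel_powr_le:
  assumes est: "sphere_estimate a b C" and C: "C > 0"
    and E: "finite E" "E \<subseteq> V" and G: "finite G" "G \<subseteq> V" and \<tau>: "\<tau> > 0"
    and lev: "\<And>y. y \<in> G \<Longrightarrow> \<tau> \<le> real (card {x \<in> E. d x y = r})"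
  shows "sum w G powr a \<le> C * K powr (real r * b) / \<tau> * sum w E powr a"
proof (cases "G = {}")
  case True
  then show ?thesis using C \<tau> by simp
next
  case False
  then have pos: "sum w G > 0" using G by (intro sum_w_pos)
  have "\<tau> * sum w G = (\<Sum>y\<in>G. w y * \<tau>)"
    by (simp add: sum_distrib_left mult.commute)
  also have "\<dots> \<le> (\<Sum>y\<in>G. w y * real (card {x \<in> E. d x y = r}))"
    using G lev by (intro sum_mono mult_left_mono) (auto intro: less_imp_le w_pos)
  also have "\<dots> = sphere_sum r E G"
    using E G by (simp add: sphere_sum_eq)
  also have "\<dots> \<le> C * K powr (real r * b) * sum w E powr a * sum w G powr (1 - a)"
    using est E G by (intro sphere_estimateD)
  finally have *: "\<tau> * sum w G \<le> C * K powr (real r * b) * sum w E powr a * sum w G powr (1 - a)" .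
  have "sum w G powr a * sum w G powr (1 - a) = sum w G"
    using pos by (simp flip: powr_add)
  then have "(\<tau> * sum w G powr a) * sum w G powr (1 - a)
      \<le> (C * K powr (real r * b) * sum w E powr a) * sum w G powr (1 - a)"
    using * by (simp add: mult.assoc)
  then have "\<tau> * sum w G powr a \<le> C * K powr (real r * b) * sum w E powr a"
    using pos by (simp add: mult_le_cancel_right)
  then show ?thesis using \<tau> by (simp add: field_simps)
qed

lemma superlevel_le:
  assumes est: "sphere_estimate a b C" and C: "C > 0" and a: "a > 0"
    and E: "finite E" "E \<subseteq> V" and G: "finite G" "G \<subseteq> V" and \<tau>: "\<tau> > 0"
    and lev: "\<And>y. y \<in> G \<Longrightarrow> \<tau> \<le> real (card {x \<in> E. d x y = r})"
  shows "sum w G \<le> (C * K powr (real r * b) / \<tau>) powr (1 / a) * sum w E"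
proof -
  have "sum w G = (sum w G powr a) powr (1 / a)"
    using a sum_w_nonneg[OF G(2)] by (simp add: powr_powr)
  also have "\<dots> \<le> (C * K powr (real r * b) / \<tau> * sum w E powr a) powr (1 / a)"
    using superlevel_powr_le[OF est C E G \<tau> lev] a by (intro powr_mono2) auto
  also have "\<dots> = (C * K powr (real r * b) / \<tau>) powr (1 / a) * sum w E"
    using C \<tau> a sum_w_nonneg[OF E(2)] by (subst powr_mult) (auto simp: powr_powr)
  finally show ?thesis .
qed

subsection \<open>The weak type bound\<close>

text \<open>This is the weak bound at one level, in terms of spheres; other levels follow by scaling
  \<open>f\<close>. The function \<open>\<rho>\<close> selects a radius for each point. The points
  of \<open>H\<close> are distributed over sets \<open>G r n\<close>, each controlled by
  \<open>superlevel_le\<close>, with decay in \<open>\<bar>real r - real n\<bar>\<close>.\<close>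

lemma weak_type_unit:
  assumes est: "sphere_estimate a \<beta> C" and C: "C > 0" and a: "a > 0" and \<beta>: "0 < \<beta>" "\<beta> < 1"
  shows "\<exists>D>0. \<forall>f H X \<rho>. finite H \<and> H \<subseteq> V \<and> finite X \<and> X \<subseteq> V \<and>
    (\<forall>y\<in>H. {x \<in> V. d x y = \<rho> y} \<subseteq> X \<and> K ^ \<rho> y < (\<Sum>x\<in>{x \<in> V. d x y = \<rho> y}. f x)) \<longrightarrow>
    sum w H \<le> D * (\<Sum>x\<in>X. \<bar>f x\<bar> powr (\<beta> / a) * w x)"
proof -
  \<comment> \<open>With this choice \<open>1 - \<gamma> = \<gamma> + \<beta>\<close>: dividing the
    growth \<open>K powr (real r * \<beta>)\<close> by a threshold of order
    \<open>K powr ((1 - \<gamma>) * (real r - real n))\<close> leaves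
    \<open>K powr (real n * \<beta>)\<close> times a decay of rate \<open>\<gamma>\<close>.\<close>
  define \<gamma> where "\<gamma> = (1 - \<beta>) / 2"
  define c where "c = 2 * (1 - K powr (- \<gamma>)) / K"
  define \<epsilon> where "\<epsilon> = min \<gamma> \<beta> / a"
  define D1 where "D1 = max C (C / c) powr (1 / a)"
  define Z where "Z = 2 / (1 - K powr (- \<epsilon>))"
  \<comment> \<open>For \<open>n > r\<close> the pigeonhole threshold would decay in
    \<open>n - r\<close>; there it is replaced by 1, since a nonempty level set has at least one
    point.\<close>
  define \<tau> where "\<tau> r n = (if n \<le> r then c * K powr ((1 - \<gamma>) * (real r - real n)) else 1)" for r n :: nat
  have \<gamma>: "0 < \<gamma>" using \<beta> by (simp add: \<gamma>_def)
  have c: "c > 0" using K \<gamma> by (simp add: c_def powr_less_one)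
  have \<epsilon>: "\<epsilon> > 0" using \<gamma> \<beta> a by (simp add: \<epsilon>_def)
  have D1: "D1 > 0" using C by (simp add: D1_def)
  have Z: "Z > 0" using K \<epsilon> by (simp add: Z_def powr_less_one)
  have \<tau>_pos: "\<tau> r n > 0" for r n using c K by (simp add: \<tau>_def)
  \<comment> \<open>The decay comes from \<open>\<gamma>\<close> when \<open>n \<le> r\<close>, and
    when \<open>n > r\<close> from \<open>real r * \<beta> = real n * \<beta> - \<beta> * (real n -
    real r)\<close>. The power \<open>1 / a\<close> explains the division by \<open>a\<close> in
    \<open>\<epsilon>\<close>.\<close>
  have const: "(C * K powr (real r * \<beta>) / \<tau> r n) powr (1 / a)
      \<le> D1 * K powr (real n * (\<beta> / a)) * K powr (- \<epsilon> * \<bar>real r - real n\<bar>)" for r n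
  proof -
    have "C * K powr (real r * \<beta>) / \<tau> r n
        \<le> max C (C / c) * K powr (real n * \<beta> - min \<gamma> \<beta> * \<bar>real r - real n\<bar>)"
    proof (cases "n \<le> r")
      case True
      have *: "1 - \<gamma> = \<gamma> + \<beta>" by (simp add: \<gamma>_def field_simps)
      have "min \<gamma> \<beta> * (real r - real n) \<le> \<gamma> * (real r - real n)"
        using True by (intro mult_right_mono) auto
      then have le: "real r * \<beta> - (1 - \<gamma>) * (real r - real n)
          \<le> real n * \<beta> - min \<gamma> \<beta> * \<bar>real r - real n\<bar>"
        using True unfolding * by (simp add: algebra_simps)
      have "C * K powr (real r * \<beta>) / \<tau> r n
          = C / c * K powr (real r * \<beta> - (1 - \<gamma>) * (real r - real n))"
        using True by (simp add: \<tau>_def powr_diff)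
      also have "\<dots> \<le> max C (C / c) * K powr (real n * \<beta> - min \<gamma> \<beta> * \<bar>real r - real n\<bar>)"
        using le K C by (intro mult_mono powr_mono) auto
      finally show ?thesis .
    next
      case False
      have "min \<gamma> \<beta> * (real n - real r) \<le> \<beta> * (real n - real r)"
        using False by (intro mult_right_mono) auto
      then have le: "real r * \<beta> \<le> real n * \<beta> - min \<gamma> \<beta> * \<bar>real r - real n\<bar>"
        using False by (simp add: algebra_simps)
      then show ?thesis
        using False K C by (auto simp: \<tau>_def intro!: mult_mono powr_mono)
    qed
    then have "(C * K powr (real r * \<beta>) / \<tau> r n) powr (1 / a)
        \<le> (max C (C / c) * K powr (real n * \<beta> - min \<gamma> \<beta> * \<bar>real r - real n\<bar>)) powr (1 / a)"
      using \<tau>_pos[of r n] C a by (intro powr_mono2) (auto intro: less_imp_le)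
    also have "\<dots> = D1 * K powr ((real n * \<beta> - min \<gamma> \<beta> * \<bar>real r - real n\<bar>) / a)"
      using C by (subst powr_mult) (auto simp: D1_def powr_powr)
    also have "(real n * \<beta> - min \<gamma> \<beta> * \<bar>real r - real n\<bar>) / a
        = real n * (\<beta> / a) + - \<epsilon> * \<bar>real r - real n\<bar>"
      using a by (simp add: \<epsilon>_def field_simps)
    finally show ?thesis by (simp only: powr_add mult.assoc)
  qed
  have main: "sum w H \<le> D1 * Z * 8 powr (\<beta> / a) * (\<Sum>x\<in>X. \<bar>f x\<bar> powr (\<beta> / a) * w x)"
    if H: "finite H" "H \<subseteq> V" and X: "finite X" "X \<subseteq> V"
      and big: "\<forall>y\<in>H. {x \<in> V. d x y = \<rho> y} \<subseteq> X \<and> K ^ \<rho> y < (\<Sum>x\<in>{x \<in> V. d x y = \<rho> y}. f x)"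
    for f H X \<rho>
  proof -
    define N where "N = (\<lambda>x. nat \<lfloor>log K (8 * f x)\<rfloor>) ` X"
    define G where "G r n = {y \<in> H. \<tau> r n \<le> real (card {x \<in> level_set K f X n. d x y = r})}" for r n
    let ?L = "level_set K f X"
    have fin: "finite N" "finite (?L n)" "finite (G r n)" for r n
      using X H by (simp_all add: N_def level_set_def G_def)
    have sub: "?L n \<subseteq> V" "G r n \<subseteq> V" for r n
      using X H by (auto simp: level_set_def G_def)
    have wG: "0 \<le> w x" if "x \<in> G r n" for x r n
      using w_pos[OF subsetD[OF sub(2) that]] by simp
    have cover: "H \<subseteq> (\<Union>n\<in>N. \<Union>r\<in>\<rho> ` H. G r n)"
    proof
      fix y assume y: "y \<in> H"
      let ?S = "{x \<in> V. d x y = \<rho> y}"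
      have yV: "y \<in> V" using y H by auto
      obtain n where n: "level_set K f ?S n \<noteq> {}"
        "c * K powr (real (\<rho> y) - real n - \<gamma> * \<bar>real n - real (\<rho> y)\<bar>) \<le> real (card (level_set K f ?S n))"
        using level_set_pigeonhole[OF K \<gamma> finite_sphere[OF yV] card_sphere[OF yV], of "\<rho> y" f] big y
        unfolding c_def by blast
      \<comment> \<open>Because \<open>X\<close> contains the whole sphere around \<open>y\<close>,
        the level sets of \<open>X\<close> and of the sphere agree on that sphere.\<close>
      have eq: "{x \<in> ?L n. d x y = \<rho> y} = level_set K f ?S n"
        using big y X by (auto simp: level_set_def)
      obtain x where x: "x \<in> level_set K f ?S n" using n by auto
      then have "x \<in> X" using eq by (auto simp: level_set_def)
      then have "n \<in> N" using level_set_unique[OF K x] by (simp add: N_def)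
      moreover have "\<tau> (\<rho> y) n \<le> real (card (level_set K f ?S n))"
      proof (cases "n \<le> \<rho> y")
        case True
        then show ?thesis using n by (simp add: \<tau>_def algebra_simps)
      next
        case False
        have "finite (level_set K f ?S n)"
          by (rule finite_subset[OF _ finite_sphere[OF yV, of "\<rho> y"]]) (auto simp: level_set_def)
        then show ?thesis
          using False n(1) by (simp add: \<tau>_def Suc_le_eq card_gt_0_iff)
      qed
      then have "y \<in> G (\<rho> y) n" using y eq by (simp add: G_def)
      ultimately show "y \<in> (\<Union>n\<in>N. \<Union>r\<in>\<rho> ` H. G r n)"
        using y by blast
    qed
    have "sum w H \<le> sum w (\<Union>n\<in>N. \<Union>r\<in>\<rho> ` H. G r n)"
      using cover fin H by (intro sum_w_mono) (auto intro: subsetD[OF sub(2)])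
    also have "\<dots> \<le> (\<Sum>n\<in>N. sum w (\<Union>r\<in>\<rho> ` H. G r n))"
      using fin H by (intro sum_UN_le) (auto intro: wG)
    also have "\<dots> \<le> (\<Sum>n\<in>N. \<Sum>r\<in>\<rho> ` H. sum w (G r n))"
      using fin H by (intro sum_mono sum_UN_le) (auto intro: wG)
    also have "\<dots> \<le> (\<Sum>n\<in>N. \<Sum>r\<in>\<rho> ` H. D1 * K powr (real n * (\<beta> / a))
        * K powr (- \<epsilon> * \<bar>real r - real n\<bar>) * sum w (?L n))"
    proof (intro sum_mono)
      fix n r
      have "sum w (G r n) \<le> (C * K powr (real r * \<beta>) / \<tau> r n) powr (1 / a) * sum w (?L n)"
        using est C a fin sub \<tau>_pos by (intro superlevel_le) (auto simp: G_def)
      also have "\<dots> \<le> D1 * K powr (real n * (\<beta> / a)) * K powr (- \<epsilon> * \<bar>real r - real n\<bar>) * sum w (?L n)"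
        using sub by (intro mult_right_mono const sum_w_nonneg)
      finally show "sum w (G r n) \<le> \<dots>" .
    qed
    \<comment> \<open>The radii are summed first: for each level \<open>n\<close> the decay factors
      add up to at most \<open>Z\<close>.\<close>
    also have "\<dots> = (\<Sum>n\<in>N. D1 * K powr (real n * (\<beta> / a)) * sum w (?L n)
        * (\<Sum>r\<in>\<rho> ` H. K powr (- \<epsilon> * \<bar>real r - real n\<bar>)))"
      by (simp add: sum_distrib_left mult_ac)
    also have "\<dots> \<le> (\<Sum>n\<in>N. D1 * K powr (real n * (\<beta> / a)) * sum w (?L n) * Z)"
      unfolding Z_def using K \<epsilon> D1 H sub
      by (intro sum_mono mult_left_mono sum_powr_dist_nat_le) (auto intro!: mult_nonneg_nonneg sum_w_nonneg)
    also have "\<dots> = D1 * Z * (\<Sum>n\<in>N. K powr (real n * (\<beta> / a)) * sum w (?L n))"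
      by (simp add: sum_distrib_left mult_ac)
    \<comment> \<open>On level \<open>n\<close> one has \<open>K powr real n \<le> 8 * f x\<close>;
      disjointness of the levels then reassembles a single sum over \<open>X\<close>.\<close>
    also have "\<dots> \<le> D1 * Z * (\<Sum>n\<in>N. \<Sum>x\<in>?L n. 8 powr (\<beta> / a) * (\<bar>f x\<bar> powr (\<beta> / a) * w x))"
    proof (intro mult_left_mono sum_mono)
      fix n
      have "K powr (real n * (\<beta> / a)) * sum w (?L n) = (\<Sum>x\<in>?L n. K powr (real n * (\<beta> / a)) * w x)"
        by (simp add: sum_distrib_left)
      also have "\<dots> \<le> (\<Sum>x\<in>?L n. 8 powr (\<beta> / a) * (\<bar>f x\<bar> powr (\<beta> / a) * w x))"
      proof (rule sum_mono)
        fix x assume x: "x \<in> ?L n"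
        have wx: "w x > 0" using w_pos[OF subsetD[OF sub(1) x]] .
        have "K powr (real n * (\<beta> / a)) = (K powr real n) powr (\<beta> / a)"
          by (simp add: powr_powr)
        also have "\<dots> \<le> (8 * \<bar>f x\<bar>) powr (\<beta> / a)"
          using x a \<beta> by (intro powr_mono2) (auto simp: level_set_def)
        also have "\<dots> = 8 powr (\<beta> / a) * \<bar>f x\<bar> powr (\<beta> / a)"
          by (subst powr_mult) auto
        finally show "K powr (real n * (\<beta> / a)) * w x \<le> 8 powr (\<beta> / a) * (\<bar>f x\<bar> powr (\<beta> / a) * w x)"
          using wx by (simp flip: mult.assoc)
      qed
      finally show "K powr (real n * (\<beta> / a)) * sum w (?L n) \<le> \<dots>" .
    qed (use D1 Z in auto)
    also have "(\<Sum>n\<in>N. \<Sum>x\<in>?L n. 8 powr (\<beta> / a) * (\<bar>f x\<bar> powr (\<beta> / a) * w x))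
        = (\<Sum>x\<in>(\<Union>n\<in>N. ?L n). 8 powr (\<beta> / a) * (\<bar>f x\<bar> powr (\<beta> / a) * w x))"
      using fin level_set_disjoint[OF K, of _ _ f X] by (intro sum.UNION_disjoint[symmetric]) auto
    also have "\<dots> \<le> (\<Sum>x\<in>X. 8 powr (\<beta> / a) * (\<bar>f x\<bar> powr (\<beta> / a) * w x))"
    proof (rule sum_mono2)
      show "0 \<le> 8 powr (\<beta> / a) * (\<bar>f x\<bar> powr (\<beta> / a) * w x)" if "x \<in> X - (\<Union>n\<in>N. ?L n)" for x
        using that X w_pos[of x] by auto
    qed (use X in \<open>auto simp: level_set_def\<close>)
    finally show ?thesis
      using D1 Z by (simp add: sum_distrib_left mult.assoc mult_left_mono)
  qed
  have "D1 * Z * 8 powr (\<beta> / a) > 0" using D1 Z by simp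
  then show ?thesis
  proof (intro exI conjI allI impI)
    fix f H X \<rho>
    assume "finite H \<and> H \<subseteq> V \<and> finite X \<and> X \<subseteq> V \<and>
      (\<forall>y\<in>H. {x \<in> V. d x y = \<rho> y} \<subseteq> X \<and> K ^ \<rho> y < (\<Sum>x\<in>{x \<in> V. d x y = \<rho> y}. f x))"
    then show "sum w H \<le> D1 * Z * 8 powr (\<beta> / a) * (\<Sum>x\<in>X. \<bar>f x\<bar> powr (\<beta> / a) * w x)"
      by (elim conjE) (rule main)
  qed
qed

subsection \<open>Exponents on both sides of \<open>1 / p\<close>\<close>

lemma sphere_sum_nonneg: "F \<subseteq> V \<Longrightarrow> sphere_sum r E F \<ge> 0"
  unfolding sphere_sum_def by (intro sum_nonneg) (auto intro: less_imp_le w_pos)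

text \<open>Each count is at most the size of a sphere. This serves as the endpoint
  \<open>a = 0\<close>, \<open>b = 1\<close> of the interpolation.\<close>

lemma sphere_sum_trivial:
  assumes "finite E" "E \<subseteq> V" "finite F" "F \<subseteq> V"
  shows "sphere_sum r E F \<le> 4 * K ^ r * sum w F"
proof -
  have "sphere_sum r E F = (\<Sum>y\<in>F. w y * real (card {x \<in> E. d x y = r}))"
    using assms by (simp add: sphere_sum_eq)
  also have "\<dots> \<le> (\<Sum>y\<in>F. w y * (4 * K ^ r))"
  proof (intro sum_mono mult_left_mono)
    fix y assume "y \<in> F"
    then have y: "y \<in> V" using assms by auto
    then show "0 \<le> w y" using w_pos by (simp add: less_imp_le)
    have "card {x \<in> E. d x y = r} \<le> card {x \<in> V. d x y = r}"
      using finite_sphere[OF y] assms by (intro card_mono) auto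
    then show "real (card {x \<in> E. d x y = r}) \<le> 4 * K ^ r"
      using card_sphere[OF y, of r] by linarith
  qed
  finally show ?thesis by (simp only: sum_distrib_right[symmetric] mult_ac)
qed

lemma sphere_estimate_mono:
  assumes "sphere_estimate a b C" "b \<le> b'" "C \<le> C'" "0 \<le> C'"
  shows "sphere_estimate a b' C'"
  unfolding sphere_estimate_def
proof (intro allI impI)
  fix E F and r :: nat
  assume EF: "finite E \<and> E \<subseteq> V \<and> finite F \<and> F \<subseteq> V"
  have "sphere_sum r E F \<le> C * K powr (real r * b) * sum w E powr a * sum w F powr (1 - a)"
    using EF assms(1) by (intro sphere_estimateD) auto
  also have "\<dots> \<le> C' * K powr (real r * b') * sum w E powr a * sum w F powr (1 - a)"
    using assms K by (intro mult_right_mono mult_mono powr_mono mult_left_mono) auto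
  finally show "sphere_sum r E F \<le> \<dots>" .
qed

text \<open>Only the set \<open>G\<close> of points of \<open>F\<close> at distance \<open>r\<close>
  from \<open>E\<close> matters, and the estimate itself, at threshold 1, bounds
  \<open>sum w G powr a\<close> by \<open>M\<close>. Trading surplus powers of the weight of
  \<open>G\<close> for powers of \<open>M\<close> raises the exponent of \<open>sum w E\<close> to
  \<open>a'\<close>, while the growth rate is multiplied by \<open>a' / a\<close>.\<close>

lemma sphere_estimate_bootstrap:
  assumes est: "sphere_estimate a b C" and C: "C > 0" and a: "0 < a" "a \<le> a'" "a' \<le> 1"
  shows "sphere_estimate a' (b * a' / a) (C powr (a' / a))"
  unfolding sphere_estimate_def
proof (intro allI impI)
  fix E F and r :: nat
  assume EF: "finite E \<and> E \<subseteq> V \<and> finite F \<and> F \<subseteq> V"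
  define G where "G = {y \<in> F. {x \<in> E. d x y = r} \<noteq> {}}"
  define M where "M = C * K powr (real r * b) * sum w E powr a"
  have G: "finite G" "G \<subseteq> V" "G \<subseteq> F" using EF by (auto simp: G_def)
  have nonneg: "sum w E \<ge> 0" "sum w G \<ge> 0" using EF G by (auto intro: sum_w_nonneg)
  have M: "M \<ge> 0" using C by (simp add: M_def)
  have "sum w G powr a \<le> C * K powr (real r * b) / 1 * sum w E powr a"
    using est C EF G
    by (intro superlevel_powr_le) (auto simp: G_def Suc_le_eq card_gt_0_iff)
  then have WG: "sum w G powr a \<le> M" by (simp add: M_def)
  have "sphere_sum r E F = sphere_sum r E G"
    unfolding sphere_sum_def using EF
    by (intro sum.cong refl) (auto simp: G_def)
  also have "\<dots> \<le> M * sum w G powr (1 - a)"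
    unfolding M_def using est EF G by (intro sphere_estimateD) auto
  \<comment> \<open>The first summand is the surplus, which is paid for by \<open>M\<close>; in the
    second, \<open>G\<close> is enlarged back to \<open>F\<close>.\<close>
  also have "1 - a = a * ((a' - a) / a) + (1 - a')" using a by (simp add: field_simps)
  also have "sum w G powr \<dots> = (sum w G powr a) powr ((a' - a) / a) * sum w G powr (1 - a')"
    by (simp only: powr_add powr_powr)
  also have "M * \<dots> \<le> M * (M powr ((a' - a) / a) * sum w F powr (1 - a'))"
    using M a WG nonneg EF G sum_w_mono[of F G]
    by (intro mult_left_mono mult_mono powr_mono2) auto
  also have "\<dots> = M powr (a' / a) * sum w F powr (1 - a')"
    using M a powr_mult_base[of M "(a' - a) / a"] by (simp add: field_simps)
  also have "M powr (a' / a) = C powr (a' / a) * K powr (real r * (b * a' / a)) * sum w E powr a'"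
    using C K a nonneg by (simp add: M_def powr_mult powr_powr mult.assoc)
  finally show "sphere_sum r E F \<le> C powr (a' / a) * K powr (real r * (b * a' / a))
      * sum w E powr a' * sum w F powr (1 - a')" .
qed

text \<open>The sphere sum is a geometric mean of itself with weights \<open>\<theta>\<close> and
  \<open>1 - \<theta>\<close>; one factor is bounded by the estimate, the other by the trivial
  bound. The condition \<open>C \<ge> 4\<close> lets one constant serve both.\<close>

lemma sphere_estimate_interpolate:
  assumes est: "sphere_estimate a b C" and C: "C \<ge> 4" and \<theta>: "0 \<le> \<theta>" "\<theta> \<le> 1"
  shows "sphere_estimate (\<theta> * a) (1 - \<theta> * (1 - b)) C"
  unfolding sphere_estimate_def
proof (intro allI impI)
  fix E F and r :: nat
  assume EF: "finite E \<and> E \<subseteq> V \<and> finite F \<and> F \<subseteq> V"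
  define T U W where "T = sphere_sum r E F" and "U = sum w E" and "W = sum w F"
  have nonneg: "T \<ge> 0" "U \<ge> 0" "W \<ge> 0"
    using EF by (auto simp: T_def U_def W_def intro: sum_w_nonneg sphere_sum_nonneg)
  have 1: "T \<le> C * K powr (real r * b) * U powr a * W powr (1 - a)"
    unfolding T_def U_def W_def using est EF by (intro sphere_estimateD) auto
  have "T \<le> 4 * K ^ r * W"
    unfolding T_def W_def using EF by (intro sphere_sum_trivial) auto
  also have "\<dots> \<le> C * K ^ r * W" using C K nonneg by (intro mult_right_mono) auto
  finally have 2: "T \<le> C * K powr real r * W" using K by (simp add: powr_realpow)
  have "T = T powr \<theta> * T powr (1 - \<theta>)" using nonneg by (simp flip: powr_add)
  also have "\<dots> \<le> (C * K powr (real r * b) * U powr a * W powr (1 - a)) powr \<theta>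
      * (C * K powr real r * W) powr (1 - \<theta>)"
    using 1 2 \<theta> nonneg by (intro mult_mono powr_mono2) auto
  also have "\<dots> = (C powr \<theta> * C powr (1 - \<theta>)) * (K powr (real r * b * \<theta>) * K powr (real r * (1 - \<theta>)))
      * U powr (a * \<theta>) * (W powr ((1 - a) * \<theta>) * W powr (1 - \<theta>))"
    using C K nonneg by (simp add: powr_mult powr_powr mult_ac)
  also have "\<dots> = C * K powr (real r * (1 - \<theta> * (1 - b))) * U powr (\<theta> * a) * W powr (1 - \<theta> * a)"
    using C by (simp add: powr_add[symmetric] algebra_simps)
  finally show "sphere_sum r E F \<le> C * K powr (real r * (1 - \<theta> * (1 - b)))
      * sum w E powr (\<theta> * a) * sum w F powr (1 - \<theta> * a)"
    by (simp add: T_def U_def W_def)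
qed

text \<open>Bootstrapping to \<open>a'\<close> gives growth rate \<open>\<beta> * a' / a\<close>,
  which is below 1 while \<open>a' < a / \<beta>\<close>; the condition
  \<open>\<beta> < a * p\<close> leaves room for such an \<open>a'\<close> above
  \<open>1 / p\<close>. Interpolation with the trivial bound then reaches exponents on both sides of
  \<open>1 / p\<close>.\<close>

lemma sphere_estimate_neighbourhood:
  assumes est: "sphere_estimate a \<beta> C" and C: "C > 0" and a: "0 < a" "a < 1"
    and \<beta>: "0 < \<beta>" "\<beta> < 1" and p: "1 < p" "\<beta> < a * p"
  shows "\<exists>\<delta> b C'. 0 < \<delta> \<and> \<delta> \<le> 1 / p \<and> 1 / p + \<delta> \<le> 1 \<and> b < 1 \<and> C' > 0 \<and>
    sphere_estimate (1 / p + \<delta>) b C' \<and> sphere_estimate (1 / p - \<delta>) b C'"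
proof -
  have "1 / p < a / \<beta>" "1 / p < 1" "a < a / \<beta>"
    using \<beta> p a by (auto simp: field_simps)
  then have "max (1 / p) a < min 1 (a / \<beta>)" using a by simp
  then obtain a' where a': "max (1 / p) a < a'" "a' < min 1 (a / \<beta>)"
    using dense by blast
  define b' where "b' = \<beta> * a' / a"
  define C' where "C' = max 4 (C powr (a' / a))"
  have b': "b' < 1" using a' a \<beta> by (simp add: b'_def field_simps)
  have "sphere_estimate a' b' (C powr (a' / a))"
    unfolding b'_def using est C a a' by (intro sphere_estimate_bootstrap) auto
  then have est': "sphere_estimate a' b' C'"
    by (rule sphere_estimate_mono) (auto simp: C'_def)
  \<comment> \<open>The second bound keeps \<open>1 / p - \<delta>\<close> positive, so that
    interpolation there still improves on growth rate 1.\<close>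
  define \<delta> where "\<delta> = min (a' - 1 / p) (1 / (2 * p))"
  have \<delta>: "0 < \<delta>" "1 / p + \<delta> \<le> a'" "0 < 1 / p - \<delta>"
    using a' p by (auto simp: \<delta>_def min_def field_simps)
  have a'0: "a' > 0" using a' a by simp
  \<comment> \<open>This is the growth rate at \<open>1 / p - \<delta>\<close>, the largest over the
    interval from \<open>1 / p - \<delta>\<close> to \<open>a'\<close>.\<close>
  define b where "b = 1 - (1 / p - \<delta>) / a' * (1 - b')"
  have "b < 1" using \<delta> a'0 b' by (simp add: b_def)
  have int: "sphere_estimate t b C'" if t: "1 / p - \<delta> \<le> t" "t \<le> a'" for t
  proof -
    have "sphere_estimate (t / a' * a') (1 - t / a' * (1 - b')) C'"
      using est' t \<delta> a'0 by (intro sphere_estimate_interpolate) (auto simp: C'_def)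
    moreover have "(1 / p - \<delta>) / a' * (1 - b') \<le> t / a' * (1 - b')"
      using t a'0 b' by (intro mult_right_mono divide_right_mono) auto
    ultimately show ?thesis
      using a'0 by (auto simp: b_def C'_def intro: sphere_estimate_mono)
  qed
  have "sphere_estimate (1 / p + \<delta>) b C'" "sphere_estimate (1 / p - \<delta>) b C'"
    using \<delta> by (auto intro!: int)
  moreover have "C' > 0" "\<delta> \<le> 1 / p" "1 / p + \<delta> \<le> 1" using \<delta> a' by (auto simp: C'_def)
  ultimately show ?thesis using \<open>b < 1\<close> \<delta> by blast
qed

subsection \<open>The kernel \<open>K\<^bsup>-d\<^esup>\<close>\<close>

text \<open>At \<open>s = 0\<close> the powers of \<open>K\<close> and the weights combine into
  \<open>P powr (1 / p) * Q powr (1 - 1 / p)\<close>, where \<open>P\<close> and \<open>Q\<close>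
  are the contributions of the two levels to the norms. Shifting the exponent by \<open>s\<close>
  costs exactly the last factor.\<close>

lemma level_pair_estimate:
  fixes n m :: real
  assumes est: "sphere_estimate (1 / p + s) b C" and C: "C > 0" and p: "p > 1"
    and s: "0 \<le> 1 / p + s" "1 / p + s \<le> 1"
    and EF: "finite E" "E \<subseteq> V" "finite F" "F \<subseteq> V"
  shows "K powr n * K powr m * sphere_sum r E F \<le> C * K powr (real r * b) *
    (K powr (n * p) * sum w E + K powr (m * (p / (p - 1))) * sum w F)
      * K powr (- s * (n * p - m * (p / (p - 1))))"
proof -
  define P Q p' a where "P = K powr (n * p) * sum w E" and "Q = K powr (m * (p / (p - 1))) * sum w F"
    and "p' = p / (p - 1)" and "a = 1 / p + s"
  have W: "sum w E \<ge> 0" "sum w F \<ge> 0" using EF by (auto intro: sum_w_nonneg)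
  then have PQ: "P \<ge> 0" "Q \<ge> 0" by (simp_all add: P_def Q_def)
  have na: "n * p * a = n + n * p * s" using p by (simp add: a_def field_simps)
  have "p' * (1 - 1 / p) = 1" using p by (simp add: p'_def field_simps)
  then have "p' * (1 - a) = 1 - p' * s" by (simp add: a_def algebra_simps)
  then have ma: "m * p' * (1 - a) = m * (1 - p' * s)" by (simp only: mult.assoc)
  have exp: "n + m = n * p * a + m * p' * (1 - a) + - s * (n * p - m * p')"
    unfolding na ma by (simp add: algebra_simps)
  have "sphere_sum r E F \<le> C * K powr (real r * b) * sum w E powr a * sum w F powr (1 - a)"
    unfolding a_def using est EF by (intro sphere_estimateD) auto
  then have "K powr (n + m) * sphere_sum r E F
      \<le> K powr (n + m) * (C * K powr (real r * b) * sum w E powr a * sum w F powr (1 - a))"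
    by (intro mult_left_mono) auto
  also have "\<dots> = C * K powr (real r * b) * (P powr a * Q powr (1 - a)) * K powr (- s * (n * p - m * p'))"
  proof -
    have "K powr (n + m) = (K powr (n * p)) powr a * (K powr (m * p')) powr (1 - a)
        * K powr (- s * (n * p - m * p'))"
      unfolding exp by (simp only: powr_add powr_powr)
    then show ?thesis
      using W K by (simp add: P_def Q_def p'_def powr_mult mult_ac)
  qed
  also have "\<dots> \<le> C * K powr (real r * b) * (P + Q) * K powr (- s * (n * p - m * p'))"
    using PQ s C by (intro mult_right_mono mult_left_mono powr_mult_powr_le_add) (auto simp: a_def)
  finally show ?thesis by (simp only: P_def Q_def p'_def powr_add)
qed

text \<open>Using the exponents on both sides of \<open>1 / p\<close> gains geometric decay away from the diagonal
  \<open>n p = m p'\<close>, so that the level sets can be summed.\<close>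

lemma level_pair_decay:
  fixes n m :: real
  assumes est: "sphere_estimate (1 / p + \<delta>) b C" "sphere_estimate (1 / p - \<delta>) b C"
    and C: "C > 0" and p: "p > 1" and \<delta>: "0 < \<delta>" "\<delta> \<le> 1 / p" "1 / p + \<delta> \<le> 1"
    and EF: "finite E" "E \<subseteq> V" "finite F" "F \<subseteq> V"
  shows "K powr n * K powr m * sphere_sum r E F \<le> C * K powr (real r * b) *
    (K powr (n * p) * sum w E + K powr (m * (p / (p - 1))) * sum w F)
      * K powr (- \<delta> * \<bar>n * p - m * (p / (p - 1))\<bar>)"
proof (cases "n * p \<ge> m * (p / (p - 1))")
  case True
  then show ?thesis
    using level_pair_estimate[of p \<delta> b C E F n m r] assms by simp
next
  case False
  then show ?thesis
    using level_pair_estimate[of p "- \<delta>" b C E F n m r] assms by (simp add: abs_if algebra_simps)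
qed

text \<open>Positivity lets \<open>f\<close> and \<open>g\<close> be split into levels indexed by
  all integers. Each pair of levels contributes \<open>P n + Q m\<close> times a decay;
  \<open>P n\<close> is then summed over \<open>m\<close>, and \<open>Q m\<close> over
  \<open>n\<close>.\<close>

lemma sum_sphere_le:
  assumes est: "sphere_estimate (1 / p + \<delta>) b C" "sphere_estimate (1 / p - \<delta>) b C"
    and C: "C > 0" and p: "p > 1" and \<delta>: "0 < \<delta>" "\<delta> \<le> 1 / p" "1 / p + \<delta> \<le> 1"
    and X: "finite X" "X \<subseteq> V" and Y: "finite Y" "Y \<subseteq> V"
    and f: "\<And>x. x \<in> X \<Longrightarrow> f x > 0" and g: "\<And>y. y \<in> Y \<Longrightarrow> g y > 0"
  shows "(\<Sum>x\<in>X. \<Sum>y\<in>{y \<in> Y. d x y = r}. f x * g y * w y)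
    \<le> C * K\<^sup>2 * (2 / (1 - K powr (- \<delta>))) * K powr (real r * b) *
      ((\<Sum>x\<in>X. f x powr p * w x) + (\<Sum>y\<in>Y. g y powr (p / (p - 1)) * w y))"
proof -
  define p' where "p' = p / (p - 1)"
  define Z where "Z = 2 / (1 - K powr (- \<delta>))"
  define E where "E n = {x \<in> X. \<lfloor>log K (f x)\<rfloor> = n}" for n
  define F where "F m = {y \<in> Y. \<lfloor>log K (g y)\<rfloor> = m}" for m
  define N M where "N = (\<lambda>x. \<lfloor>log K (f x)\<rfloor>) ` X" and "M = (\<lambda>y. \<lfloor>log K (g y)\<rfloor>) ` Y"
  define P Q where "P n = K powr (of_int n * p) * sum w (E n)"
    and "Q m = K powr (of_int m * p') * sum w (F m)" for n m
  have p': "p' > 1" using p by (simp add: p'_def field_simps)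
  have Z: "Z > 0" using K \<delta> by (simp add: Z_def powr_less_one)
  have fin: "finite (E n)" "finite (F n)" "finite N" "finite M" for n
    using X Y by (auto simp: E_def F_def N_def M_def)
  have sub: "E n \<subseteq> V" "F n \<subseteq> V" for n using X Y by (auto simp: E_def F_def)
  have PQ: "P n \<ge> 0" "Q n \<ge> 0" for n
    by (auto simp: P_def Q_def sum_w_nonneg sub)
  have level: "K powr of_int n \<le> f x \<and> f x \<le> K * K powr of_int n" if "x \<in> E n" for x n
    using powr_floor_log_bounds[of K "f x"] f[of x] that K by (auto simp: E_def powr_add mult.commute)
  have level': "K powr of_int m \<le> g y \<and> g y \<le> K * K powr of_int m" if "y \<in> F m" for y m
    using powr_floor_log_bounds[of K "g y"] g[of y] that K by (auto simp: F_def powr_add mult.commute)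
  have wV: "w x \<ge> 0" if "x \<in> V" for x using w_pos[OF that] by simp
  have "(\<Sum>x\<in>X. \<Sum>y\<in>{y \<in> Y. d x y = r}. f x * g y * w y)
      = (\<Sum>x\<in>X. \<Sum>y\<in>Y. if d x y = r then f x * g y * w y else 0)"
    by (rule sum.cong) (simp_all add: sum.inter_filter Y)
  also have "\<dots> = (\<Sum>n\<in>N. \<Sum>x\<in>E n. \<Sum>m\<in>M. \<Sum>y\<in>F m. if d x y = r then f x * g y * w y else 0)"
    unfolding N_def M_def E_def F_def
    by (subst sum.image_gen[OF X(1), of _ "\<lambda>x. \<lfloor>log K (f x)\<rfloor>"], subst sum.image_gen[OF Y(1), of _ "\<lambda>y. \<lfloor>log K (g y)\<rfloor>"]) simp
  also have "\<dots> = (\<Sum>n\<in>N. \<Sum>m\<in>M. \<Sum>x\<in>E n. \<Sum>y\<in>F m. if d x y = r then f x * g y * w y else 0)"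
    by (intro sum.cong refl sum.swap)
  also have "\<dots> \<le> (\<Sum>n\<in>N. \<Sum>m\<in>M. K\<^sup>2 * (C * K powr (real r * b) * (P n + Q m)
      * K powr (- \<delta> * \<bar>of_int n * p - of_int m * p'\<bar>)))"
  proof (intro sum_mono)
    fix n m
    have "(\<Sum>x\<in>E n. \<Sum>y\<in>F m. if d x y = r then f x * g y * w y else 0)
        \<le> (\<Sum>x\<in>E n. \<Sum>y\<in>F m. if d x y = r then K\<^sup>2 * (K powr of_int n * K powr of_int m) * w y else 0)"
    proof (intro sum_mono)
      fix x y assume xy: "x \<in> E n" "y \<in> F m"
      \<comment> \<open>Rounding each function to its level loses a factor \<open>K\<close>, which
        accounts for \<open>K\<^sup>2\<close>.\<close>
      have "f x * g y \<le> (K * K powr of_int n) * (K * K powr of_int m)"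
        using xy level level' g[of y] K by (intro mult_mono) (auto simp: F_def intro: less_imp_le)
      also have "\<dots> = K\<^sup>2 * (K powr of_int n * K powr of_int m)"
        by (simp add: power2_eq_square mult_ac)
      finally have "f x * g y * w y \<le> K\<^sup>2 * (K powr of_int n * K powr of_int m) * w y"
        using wV[OF subsetD[OF sub(2) xy(2)]] by (rule mult_right_mono)
      then show "(if d x y = r then f x * g y * w y else 0)
          \<le> (if d x y = r then K\<^sup>2 * (K powr of_int n * K powr of_int m) * w y else 0)" by simp
    qed
    also have "\<dots> = (\<Sum>x\<in>E n. \<Sum>y\<in>{y \<in> F m. d x y = r}. K\<^sup>2 * (K powr of_int n * K powr of_int m) * w y)"
      by (rule sum.cong) (simp_all add: sum.inter_filter fin)
    also have "\<dots> = K\<^sup>2 * (K powr of_int n * K powr of_int m * sphere_sum r (E n) (F m))"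
      by (simp add: sphere_sum_def sum_distrib_left mult_ac)
    also have "\<dots> \<le> K\<^sup>2 * (C * K powr (real r * b) * (P n + Q m)
        * K powr (- \<delta> * \<bar>of_int n * p - of_int m * p'\<bar>))"
      unfolding P_def Q_def p'_def using est C p \<delta> fin sub
      by (intro mult_left_mono level_pair_decay) auto
    finally show "(\<Sum>x\<in>E n. \<Sum>y\<in>F m. if d x y = r then f x * g y * w y else 0) \<le> \<dots>" .
  qed
  also have "\<dots> = C * K\<^sup>2 * K powr (real r * b) * (\<Sum>n\<in>N. \<Sum>m\<in>M. (P n + Q m)
      * K powr (- \<delta> * \<bar>of_int n * p - of_int m * p'\<bar>))"
    by (simp only: sum_distrib_left mult_ac)
  also have "\<dots> = C * K\<^sup>2 * K powr (real r * b) *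
      ((\<Sum>n\<in>N. P n * (\<Sum>m\<in>M. K powr (- \<delta> * \<bar>of_int n * p - of_int m * p'\<bar>)))
      + (\<Sum>m\<in>M. Q m * (\<Sum>n\<in>N. K powr (- \<delta> * \<bar>of_int n * p - of_int m * p'\<bar>))))"
    unfolding distrib_right sum.distrib sum_distrib_left
    by (subst (4) sum.swap) simp
  also have "\<dots> \<le> C * K\<^sup>2 * K powr (real r * b) * ((\<Sum>n\<in>N. P n * Z) + (\<Sum>m\<in>M. Q m * Z))"
  proof (intro mult_left_mono add_mono sum_mono PQ)
    \<comment> \<open>Since \<open>p\<close> and \<open>p'\<close> both exceed 1, the distance from
      the diagonal dominates the distance of either index from a fixed real number, so
      \<open>sum_powr_dist_le\<close> applies in both directions.\<close>
    have le: "\<bar>u - t / q\<bar> \<le> \<bar>t - u * q\<bar>" if "q > 1" for u t q :: real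
    proof -
      have "\<bar>t - u * q\<bar> = q * \<bar>u - t / q\<bar>"
      proof -
        have "t - u * q = - q * (u - t / q)" using that by (simp add: field_simps)
        then show ?thesis using that by (simp add: abs_mult)
      qed
      moreover have "1 * \<bar>u - t / q\<bar> \<le> q * \<bar>u - t / q\<bar>"
        using that by (intro mult_right_mono) auto
      ultimately show ?thesis by simp
    qed
    show "(\<Sum>m\<in>M. K powr (- \<delta> * \<bar>of_int n * p - of_int m * p'\<bar>)) \<le> Z" for n
    proof -
      have "(\<Sum>m\<in>M. K powr (- \<delta> * \<bar>of_int n * p - of_int m * p'\<bar>))
          \<le> (\<Sum>m\<in>M. K powr (- \<delta> * \<bar>of_int m - of_int n * p / p'\<bar>))"
        using le[OF p'] K \<delta> by (intro sum_mono powr_mono) auto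
      then show ?thesis
        using sum_powr_dist_le[OF K \<delta>(1) fin(4), of "of_int n * p / p'"] by (simp add: Z_def)
    qed
    show "(\<Sum>n\<in>N. K powr (- \<delta> * \<bar>of_int n * p - of_int m * p'\<bar>)) \<le> Z" for m
    proof -
      have "(\<Sum>n\<in>N. K powr (- \<delta> * \<bar>of_int n * p - of_int m * p'\<bar>))
          \<le> (\<Sum>n\<in>N. K powr (- \<delta> * \<bar>of_int n - of_int m * p' / p\<bar>))"
      proof (intro sum_mono powr_mono)
        fix n
        show "- \<delta> * \<bar>of_int n * p - of_int m * p'\<bar> \<le> - \<delta> * \<bar>of_int n - of_int m * p' / p\<bar>"
          using le[OF p, of "of_int n" "of_int m * p'"] \<delta> by (simp add: abs_minus_commute)
      qed (use K in auto)
      then show ?thesis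
        using sum_powr_dist_le[OF K \<delta>(1) fin(3), of "of_int m * p' / p"] by (simp add: Z_def)
    qed
  qed (use C in auto)
  also have "\<dots> = C * K\<^sup>2 * Z * K powr (real r * b) * ((\<Sum>n\<in>N. P n) + (\<Sum>m\<in>M. Q m))"
    unfolding sum_distrib_right[symmetric] by (simp add: algebra_simps)
  also have "\<dots> \<le> C * K\<^sup>2 * Z * K powr (real r * b) *
      ((\<Sum>x\<in>X. f x powr p * w x) + (\<Sum>y\<in>Y. g y powr p' * w y))"
  proof (intro mult_left_mono add_mono)
    have "P n \<le> (\<Sum>x\<in>E n. f x powr p * w x)" for n
      unfolding P_def sum_distrib_left powr_powr[symmetric] using level p
      by (intro sum_mono mult_right_mono powr_mono2 wV subsetD[OF sub(1)]) auto
    then have "(\<Sum>n\<in>N. P n) \<le> (\<Sum>n\<in>N. \<Sum>x\<in>E n. f x powr p * w x)"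
      by (intro sum_mono)
    then show "(\<Sum>n\<in>N. P n) \<le> (\<Sum>x\<in>X. f x powr p * w x)"
      by (subst sum.image_gen[OF X(1), of _ "\<lambda>x. \<lfloor>log K (f x)\<rfloor>"]) (simp add: N_def E_def)
    have "Q m \<le> (\<Sum>y\<in>F m. g y powr p' * w y)" for m
      unfolding Q_def sum_distrib_left powr_powr[symmetric] using level' p'
      by (intro sum_mono mult_right_mono powr_mono2 wV subsetD[OF sub(2)]) auto
    then have "(\<Sum>m\<in>M. Q m) \<le> (\<Sum>m\<in>M. \<Sum>y\<in>F m. g y powr p' * w y)"
      by (intro sum_mono)
    then show "(\<Sum>m\<in>M. Q m) \<le> (\<Sum>y\<in>Y. g y powr p' * w y)"
      by (subst sum.image_gen[OF Y(1), of _ "\<lambda>y. \<lfloor>log K (g y)\<rfloor>"]) (simp add: M_def F_def)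
  qed (use C Z K in auto)
  finally show ?thesis by (simp only: Z_def p'_def)
qed

text \<open>The right side is the additive form of the product of the norms in \<open>L^p(w)\<close>
  and \<open>L^p'(w)\<close>, as in Young's inequality. It is not homogeneous in \<open>f\<close>
  and \<open>g\<close> separately, so a scaling factor is inserted when it is applied.\<close>

definition kernel_bounded :: "real \<Rightarrow> real \<Rightarrow> bool" where
  "kernel_bounded p D \<longleftrightarrow> (\<forall>X Y f g. finite X \<and> X \<subseteq> V \<and> finite Y \<and> Y \<subseteq> V \<and> (\<forall>x\<in>X. f x \<ge> 0) \<and> (\<forall>y\<in>Y. g y \<ge> 0) \<longrightarrow>
    (\<Sum>x\<in>X. \<Sum>y\<in>Y. K powr (- real (d x y)) * (f x * g y * w y))
    \<le> D * ((\<Sum>x\<in>X. f x powr p * w x) + (\<Sum>y\<in>Y. g y powr (p / (p - 1)) * w y)))"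

lemma kernel_boundedD:
  assumes "kernel_bounded p D" "finite X" "X \<subseteq> V" "finite Y" "Y \<subseteq> V"
    "\<And>x. x \<in> X \<Longrightarrow> f x \<ge> 0" "\<And>y. y \<in> Y \<Longrightarrow> g y \<ge> 0"
  shows "(\<Sum>x\<in>X. \<Sum>y\<in>Y. K powr (- real (d x y)) * (f x * g y * w y))
    \<le> D * ((\<Sum>x\<in>X. f x powr p * w x) + (\<Sum>y\<in>Y. g y powr (p / (p - 1)) * w y))"
  using assms(1)[unfolded kernel_bounded_def, rule_format, of X Y f g] assms(2-) by simp

text \<open>Pairs are sorted by distance. Radius \<open>r\<close> contributes a multiple of
  \<open>K powr (- real r) * K powr (real r * b)\<close>, a summable sequence because
  \<open>b < 1\<close>.\<close>

lemma kernel_bilinear_bound: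
  assumes est: "sphere_estimate (1 / p + \<delta>) b C" "sphere_estimate (1 / p - \<delta>) b C"
    and C: "C > 0" and p: "p > 1" and \<delta>: "0 < \<delta>" "\<delta> \<le> 1 / p" "1 / p + \<delta> \<le> 1" and b: "b < 1"
  shows "\<exists>D>0. kernel_bounded p D"
proof -
  define D0 where "D0 = C * K\<^sup>2 * (2 / (1 - K powr (- \<delta>)))"
  define D where "D = D0 * (2 / (1 - K powr (- (1 - b))))"
  have D0: "D0 > 0" using C K \<delta> by (simp add: D0_def powr_less_one)
  have D: "D > 0" using D0 K b by (simp add: D_def powr_less_one)
  have main: "(\<Sum>x\<in>X. \<Sum>y\<in>Y. K powr (- real (d x y)) * (f x * g y * w y))
    \<le> D * ((\<Sum>x\<in>X. f x powr p * w x) + (\<Sum>y\<in>Y. g y powr (p / (p - 1)) * w y))"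
    if X: "finite X" "X \<subseteq> V" and Y: "finite Y" "Y \<subseteq> V"
      and f: "\<forall>x\<in>X. f x \<ge> 0" and g: "\<forall>y\<in>Y. g y \<ge> 0" for X Y f g
  proof -
    \<comment> \<open>Zeros are discarded because the level decomposition takes logarithms.\<close>
    define X' Y' where "X' = {x \<in> X. f x > 0}" and "Y' = {y \<in> Y. g y > 0}"
    define R where "R = (\<lambda>(x, y). d x y) ` (X' \<times> Y')"
    define B where "B = (\<Sum>x\<in>X'. f x powr p * w x) + (\<Sum>y\<in>Y'. g y powr (p / (p - 1)) * w y)"
    have fin: "finite X'" "finite Y'" "finite R" using X Y by (auto simp: X'_def Y'_def R_def)
    have sub: "X' \<subseteq> V" "Y' \<subseteq> V" using X Y by (auto simp: X'_def Y'_def)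
    have wV: "w x \<ge> 0" if "x \<in> V" for x using w_pos[OF that] by simp
    have f0: "f x = 0" if "x \<in> X - X'" for x
      using that f by (force simp: X'_def)
    have g0: "g y = 0" if "y \<in> Y - Y'" for y
      using that g by (force simp: Y'_def)
    have sub': "X' \<subseteq> X" "Y' \<subseteq> Y" by (auto simp: X'_def Y'_def)
    have "B \<ge> 0"
      using sub unfolding B_def
      by (intro add_nonneg_nonneg sum_nonneg mult_nonneg_nonneg wV) auto
    have "(\<Sum>x\<in>X. \<Sum>y\<in>Y. K powr (- real (d x y)) * (f x * g y * w y))
        = (\<Sum>x\<in>X'. \<Sum>y\<in>Y. K powr (- real (d x y)) * (f x * g y * w y))"
      by (rule sum.mono_neutral_right) (simp_all add: X sub' f0)
    also have "\<dots> = (\<Sum>x\<in>X'. \<Sum>y\<in>Y'. K powr (- real (d x y)) * (f x * g y * w y))"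
      by (intro sum.cong refl sum.mono_neutral_right) (simp_all add: Y sub' g0)
    also have "\<dots> = (\<Sum>x\<in>X'. \<Sum>r\<in>R. \<Sum>y\<in>{y \<in> Y'. d x y = r}. K powr (- real (d x y)) * (f x * g y * w y))"
      by (intro sum.cong refl sum.group[symmetric] fin) (auto simp: R_def)
    also have "\<dots> = (\<Sum>r\<in>R. \<Sum>x\<in>X'. \<Sum>y\<in>{y \<in> Y'. d x y = r}. K powr (- real (d x y)) * (f x * g y * w y))"
      by (rule sum.swap)
    also have "\<dots> = (\<Sum>r\<in>R. K powr (- real r) * (\<Sum>x\<in>X'. \<Sum>y\<in>{y \<in> Y'. d x y = r}. f x * g y * w y))"
      by (simp add: sum_distrib_left)
    also have "\<dots> \<le> (\<Sum>r\<in>R. K powr (- real r) * (D0 * K powr (real r * b) * B))"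
      unfolding D0_def B_def using est C p \<delta> fin sub
      by (intro sum_mono mult_left_mono sum_sphere_le) (auto simp: X'_def Y'_def)
    also have "\<dots> = D0 * B * (\<Sum>r\<in>R. K powr (- (1 - b) * \<bar>real r - 0\<bar>))"
      unfolding sum_distrib_left
    proof (rule sum.cong)
      fix r
      have "K powr (- (1 - b) * \<bar>real r - 0\<bar>) = K powr (- real r) * K powr (real r * b)"
        by (simp add: powr_add[symmetric] algebra_simps)
      then show "K powr (- real r) * (D0 * K powr (real r * b) * B)
          = D0 * B * K powr (- (1 - b) * \<bar>real r - 0\<bar>)" by simp
    qed simp
    also have "\<dots> \<le> D0 * B * (2 / (1 - K powr (- (1 - b))))"
      using D0 \<open>B \<ge> 0\<close> b K fin by (intro mult_left_mono sum_powr_dist_nat_le) auto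
    also have "\<dots> = D * B" by (simp add: D_def)
    also have "\<dots> \<le> D * ((\<Sum>x\<in>X. f x powr p * w x) + (\<Sum>y\<in>Y. g y powr (p / (p - 1)) * w y))"
      unfolding B_def
    proof (intro mult_left_mono add_mono sum_mono2)
      show "0 \<le> f x powr p * w x" if "x \<in> X - X'" for x
        using w_pos[of x] X that by auto
      show "0 \<le> g y powr (p / (p - 1)) * w y" if "y \<in> Y - Y'" for y
        using w_pos[of y] Y that by auto
    qed (use X Y D sub' in simp_all)
    finally show ?thesis .
  qed
  show ?thesis
    unfolding kernel_bounded_def
    by (rule exI[of _ D], rule conjI[OF D], intro allI impI, elim conjE, rule main)
qed

definition kernel_sum :: "('a \<Rightarrow> real) \<Rightarrow> 'a set \<Rightarrow> 'a \<Rightarrow> real" where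
  "kernel_sum f X y = (\<Sum>x\<in>X. K powr (- real (d x y)) * f x)"

lemma kernel_sum_nonneg: "(\<And>x. x \<in> X \<Longrightarrow> f x \<ge> 0) \<Longrightarrow> kernel_sum f X y \<ge> 0"
  unfolding kernel_sum_def by (intro sum_nonneg) auto

text \<open>The bilinear bound is tested on \<open>g = h\<^sup>p\<^sup>-\<^sup>1\<close>, where \<open>h\<close> is the kernel sum itself; the scaling
  of \<open>f\<close> by \<open>2 D\<close> lets the resulting term be absorbed.\<close>

lemma kernel_strong_type:
  assumes kb: "kernel_bounded p D" and D: "D > 0" and p: "p > 1"
    and X: "finite X" "X \<subseteq> V" and Y: "finite Y" "Y \<subseteq> V" and f: "\<And>x. x \<in> X \<Longrightarrow> f x \<ge> 0"
  shows "(\<Sum>y\<in>Y. kernel_sum f X y powr p * w y) \<le> (2 * D) powr p * (\<Sum>x\<in>X. f x powr p * w x)"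
proof -
  define h where "h = kernel_sum f X"
  define H where "H = (\<Sum>y\<in>Y. h y powr p * w y)"
  have h: "h y \<ge> 0" for y unfolding h_def using f by (rule kernel_sum_nonneg)
  have "2 * D * H = (\<Sum>y\<in>Y. \<Sum>x\<in>X. K powr (- real (d x y)) * (2 * D * f x * h y powr (p - 1) * w y))"
    unfolding H_def sum_distrib_left
  proof (rule sum.cong)
    fix y
    have "h y powr p = h y * h y powr (p - 1)"
      using powr_mult_base[OF h, of y "p - 1"] by simp
    also have "\<dots> = (\<Sum>x\<in>X. K powr (- real (d x y)) * f x) * h y powr (p - 1)"
      by (simp only: h_def kernel_sum_def)
    finally show "2 * D * (h y powr p * w y)
        = (\<Sum>x\<in>X. K powr (- real (d x y)) * (2 * D * f x * h y powr (p - 1) * w y))"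
      by (simp add: sum_distrib_left sum_distrib_right mult_ac)
  qed simp
  also have "\<dots> = (\<Sum>x\<in>X. \<Sum>y\<in>Y. K powr (- real (d x y)) * (2 * D * f x * h y powr (p - 1) * w y))"
    by (rule sum.swap)
  also have "\<dots> \<le> D * ((\<Sum>x\<in>X. (2 * D * f x) powr p * w x) + (\<Sum>y\<in>Y. (h y powr (p - 1)) powr (p / (p - 1)) * w y))"
    by (rule kernel_boundedD[OF kb X Y]) (use D f in auto)
  also have "(\<Sum>y\<in>Y. (h y powr (p - 1)) powr (p / (p - 1)) * w y) = H"
    using p by (simp add: H_def powr_powr)
  also have "(\<Sum>x\<in>X. (2 * D * f x) powr p * w x) = (2 * D) powr p * (\<Sum>x\<in>X. f x powr p * w x)"
    unfolding sum_distrib_left using D f by (intro sum.cong refl) (simp add: powr_mult)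
  finally have "D * H \<le> D * ((2 * D) powr p * (\<Sum>x\<in>X. f x powr p * w x))"
    by (simp add: algebra_simps)
  then show ?thesis using D by (simp add: H_def h_def)
qed

text \<open>Dually, the bound is tested on \<open>f = (h / w)\<^bsup>1 / (p - 1)\<^esup>\<close> and \<open>g = 2 D \<phi> / w\<close>.\<close>

lemma kernel_strong_type_dual:
  fixes p :: real
  assumes kb: "kernel_bounded p D" and D: "D > 0" and p: "p > 1"
    and sym: "\<And>x y. x \<in> V \<Longrightarrow> y \<in> V \<Longrightarrow> d x y = d y x"
    and X: "finite X" "X \<subseteq> V" and Y: "finite Y" "Y \<subseteq> V" and \<phi>: "\<And>x. x \<in> X \<Longrightarrow> \<phi> x \<ge> 0"
  defines "p' \<equiv> p / (p - 1)" and "\<sigma> \<equiv> \<lambda>x. w x powr (- (1 / (p - 1)))"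
  shows "(\<Sum>y\<in>Y. kernel_sum \<phi> X y powr p' * \<sigma> y) \<le> (2 * D) powr p' * (\<Sum>x\<in>X. \<phi> x powr p' * \<sigma> x)"
proof -
  define h where "h = kernel_sum \<phi> X"
  define u where "u y = (h y / w y) powr (1 / (p - 1))" for y
  define H where "H = (\<Sum>y\<in>Y. h y powr p' * \<sigma> y)"
  have h: "h y \<ge> 0" for y unfolding h_def using \<phi> by (rule kernel_sum_nonneg)
  have exp: "1 / (p - 1) + 1 = p'" "1 / (p - 1) * p = p'" "1 - p' = - (1 / (p - 1))"
    using p by (simp_all add: p'_def field_simps)
  \<comment> \<open>The dual weight is \<open>w powr (1 - p')\<close>, so the norm of
    \<open>\<phi>\<close> in \<open>L^p'(\<sigma>)\<close> is the norm of \<open>\<phi> / w\<close>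
    in \<open>L^p'(w)\<close>.\<close>
  have w1: "w x powr (- (1 / (p - 1))) = w x * w x powr (- p')" if "x \<in> V" for x
    using powr_mult_base[of "w x" "- p'"] w_pos[OF that] exp(3) by simp
  have uh: "u y * h y = h y powr p' * \<sigma> y" if "y \<in> V" for y
  proof -
    have "u y * h y = h y * h y powr (1 / (p - 1)) / w y powr (1 / (p - 1))"
      using h[of y] w_pos[OF that] by (simp add: u_def powr_divide)
    also have "h y * h y powr (1 / (p - 1)) = h y powr p'"
      using powr_mult_base[OF h, of y "1 / (p - 1)"] exp(1) by (simp add: add.commute)
    finally show ?thesis by (simp add: \<sigma>_def powr_minus divide_inverse)
  qed
  have up: "u y powr p * w y = h y powr p' * \<sigma> y" if "y \<in> V" for y
  proof -
    have "u y powr p = (h y / w y) powr p'"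
      using exp(2) by (simp add: u_def powr_powr)
    also have "\<dots> = h y powr p' * w y powr (- p')"
      using h[of y] w_pos[OF that] by (simp add: powr_divide powr_minus_divide)
    finally show ?thesis using w1[OF that] by (simp add: \<sigma>_def mult_ac)
  qed
  have gp: "(2 * D * \<phi> x / w x) powr p' * w x = (2 * D) powr p' * (\<phi> x powr p' * \<sigma> x)" if "x \<in> X" for x
  proof -
    have x: "x \<in> V" using that X by auto
    have "(2 * D * \<phi> x / w x) powr p' = (2 * D) powr p' * \<phi> x powr p' * w x powr (- p')"
      using \<phi>[OF that] w_pos[OF x] D by (simp add: powr_divide powr_mult powr_minus_divide)
    then show ?thesis using w1[OF x] by (simp add: \<sigma>_def mult_ac)
  qed
  \<comment> \<open>The bilinear bound is applied with \<open>X\<close> and \<open>Y\<close>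
    exchanged, which is where the symmetry of \<open>d\<close> enters.\<close>
  have "2 * D * H = (\<Sum>y\<in>Y. \<Sum>x\<in>X. K powr (- real (d y x)) * (u y * (2 * D * \<phi> x / w x) * w x))"
    unfolding H_def sum_distrib_left
  proof (rule sum.cong)
    fix y assume "y \<in> Y"
    then have y: "y \<in> V" using Y by auto
    have "2 * D * (h y powr p' * \<sigma> y) = 2 * D * u y * (\<Sum>x\<in>X. K powr (- real (d x y)) * \<phi> x)"
      using uh[OF y] by (simp add: h_def kernel_sum_def)
    also have "\<dots> = (\<Sum>x\<in>X. K powr (- real (d y x)) * (u y * (2 * D * \<phi> x / w x) * w x))"
      unfolding sum_distrib_left
    proof (rule sum.cong)
      fix x assume "x \<in> X"
      then have x: "x \<in> V" using X by auto
      show "2 * D * u y * (K powr (- real (d x y)) * \<phi> x)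
          = K powr (- real (d y x)) * (u y * (2 * D * \<phi> x / w x) * w x)"
        using w_pos[OF x] sym[OF x y] by simp
    qed simp
    finally show "2 * D * (h y powr p' * \<sigma> y) = \<dots>" .
  qed simp
  also have "\<dots> \<le> D * ((\<Sum>y\<in>Y. u y powr p * w y) + (\<Sum>x\<in>X. (2 * D * \<phi> x / w x) powr (p / (p - 1)) * w x))"
  proof (rule kernel_boundedD[OF kb Y X])
    show "0 \<le> u y" for y by (simp add: u_def)
    show "0 \<le> 2 * D * \<phi> x / w x" if "x \<in> X" for x
      using \<phi>[OF that] D w_pos[of x] X that by (auto intro!: divide_nonneg_pos)
  qed
  also have "(\<Sum>y\<in>Y. u y powr p * w y) = H"
    unfolding H_def using up Y by (intro sum.cong) auto
  also have "(\<Sum>x\<in>X. (2 * D * \<phi> x / w x) powr (p / (p - 1)) * w x)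
      = (2 * D) powr p' * (\<Sum>x\<in>X. \<phi> x powr p' * \<sigma> x)"
    using gp by (simp add: sum_distrib_left p'_def)
  finally have "D * H \<le> D * ((2 * D) powr p' * (\<Sum>x\<in>X. \<phi> x powr p' * \<sigma> x))"
    by (simp add: algebra_simps)
  then show ?thesis using D by (simp add: H_def h_def)
qed

end

section \<open>Growth of balls in the tree\<close>

lemma tree_dist_eq: "tree_path k x y p \<Longrightarrow> tree_dist k x y = length p - 1"
  unfolding tree_dist_def using tree_path_unique by (metis the_equality)

lemma tree_path_rev: "tree_path k x y p \<Longrightarrow> tree_path k y x (rev p)"
proof -
  have "tree_adj u v = tree_adj v u" for u v by (auto simp: tree_adj_def)
  then show "tree_path k x y p \<Longrightarrow> tree_path k y x (rev p)"
    by (simp add: tree_path_def hd_rev last_rev)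
qed

lemma tree_dist_sym:
  assumes "x \<in> kary_tree k" "y \<in> kary_tree k"
  shows "tree_dist k x y = tree_dist k y x"
proof -
  obtain p where "tree_path k x y p" using tree_path_exists[OF assms] by blast
  then show ?thesis using tree_dist_eq tree_path_rev by (metis length_rev)
qed

text \<open>Induction from the start of the walk: moving first to the parent costs one more dropped
  letter; moving to a child adds a letter that is either cancelled by a drop or becomes the last
  letter of \<open>u\<close>. Each step changes \<open>length u + j\<close> by at most one.\<close>

lemma walk_last_eq:
  assumes "successively tree_adj p" "p \<noteq> []"
  shows "\<exists>u j. last p = u @ drop j (hd p) \<and> length u + j \<le> length p - 1"
  using assms
proof (induction p)
  case (Cons x q)
  show ?case
  proof (cases q)
    case Nil
    then show ?thesis by (auto intro: exI[of _ "[]"] exI[of _ 0])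
  next
    case (Cons v r)
    then obtain u j where u: "last q = u @ drop j v" "length u + j \<le> length q - 1"
      using Cons.IH Cons.prems by auto
    have len: "length q \<ge> 1" using Cons by simp
    have "tree_adj x v" using Cons Cons.prems by simp
    then consider i where "v = i # x" | i where "x = i # v" by (auto simp: tree_adj_def)
    then show ?thesis
    proof cases
      case 1
      show ?thesis
      proof (cases j)
        case 0
        then show ?thesis using u 1 Cons by (intro exI[of _ "u @ [i]"] exI[of _ 0]) auto
      next
        case (Suc j')
        then show ?thesis using u 1 len \<open>q = v # r\<close> by (intro exI[of _ u] exI[of _ j']) auto
      qed
    next
      case 2
      then show ?thesis using u len \<open>q = v # r\<close> by (intro exI[of _ u] exI[of _ "Suc j"]) auto
    qed
  qed
qed simp

text \<open>A point of the ball is reached by climbing \<open>j\<close> levels from \<open>x\<close>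
  and descending along a word \<open>u\<close>; the index \<open>m\<close> is the total
  length.\<close>

lemma tree_ball_subset:
  assumes "x \<in> kary_tree k"
  shows "tree_ball k x r \<subseteq> (\<Union>m\<le>r. \<Union>j\<le>m. (\<lambda>u. u @ drop j x) ` {u. set u \<subseteq> {..<k} \<and> length u = m - j})"
proof
  fix y assume "y \<in> tree_ball k x r"
  then have y: "y \<in> kary_tree k" "tree_dist k x y \<le> r" by (auto simp: tree_ball_def)
  obtain p where p: "tree_path k x y p" using tree_path_exists[OF assms y(1)] by blast
  then obtain u j where u: "y = u @ drop j x" "length u + j \<le> length p - 1"
    using walk_last_eq[of p] by (auto simp: tree_path_def)
  have "set u \<subseteq> {..<k}" using u y by (auto simp: kary_tree_def)
  moreover have "length u + j \<le> r" using u y tree_dist_eq[OF p] by simp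
  ultimately show "y \<in> (\<Union>m\<le>r. \<Union>j\<le>m. (\<lambda>u. u @ drop j x) ` {u. set u \<subseteq> {..<k} \<and> length u = m - j})"
    using u by (intro UN_I[of "length u + j"] UN_I[of j] image_eqI[of _ _ u]) auto
qed

lemma finite_tree_ball:
  assumes "x \<in> kary_tree k"
  shows "finite (tree_ball k x r)"
  by (rule finite_subset[OF tree_ball_subset[OF assms]]) (simp add: finite_lists_length_eq)

lemma sum_power_le_double:
  assumes "k \<ge> (2::nat)"
  shows "(\<Sum>m\<le>r. k ^ m) \<le> 2 * k ^ r"
proof (induction r)
  case (Suc r)
  have "2 * k ^ r \<le> k * k ^ r" using assms by (intro mult_right_mono) auto
  then show ?case using Suc unfolding sum.atMost_Suc power_Suc by linarith
qed simp

text \<open>There are at most \<open>k ^ (m - j)\<close> descents for each \<open>m\<close> and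
  \<open>j\<close>, and each of the two nested geometric sums costs a factor 2.\<close>

lemma card_tree_ball_le:
  assumes "x \<in> kary_tree k" "k \<ge> 2"
  shows "card (tree_ball k x r) \<le> 4 * k ^ r"
proof -
  let ?U = "\<lambda>m j. (\<lambda>u. u @ drop j x) ` {u. set u \<subseteq> {..<k} \<and> length u = m - j}"
  have card: "card (?U m j) \<le> k ^ (m - j)" for m j
    using card_image_le[of "{u. set u \<subseteq> {..<k} \<and> length u = m - j}" "\<lambda>u. u @ drop j x"]
    by (simp add: finite_lists_length_eq card_lists_length_eq)
  have "card (tree_ball k x r) \<le> card (\<Union>m\<le>r. \<Union>j\<le>m. ?U m j)"
    by (intro card_mono tree_ball_subset assms) (simp add: finite_lists_length_eq)
  also have "\<dots> \<le> (\<Sum>m\<le>r. card (\<Union>j\<le>m. ?U m j))" by (rule card_UN_le) simp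
  also have "\<dots> \<le> (\<Sum>m\<le>r. \<Sum>j\<le>m. card (?U m j))" by (intro sum_mono card_UN_le) simp
  also have "\<dots> \<le> (\<Sum>m\<le>r. \<Sum>j\<le>m. k ^ (m - j))" by (intro sum_mono card)
  also have "\<dots> = (\<Sum>m\<le>r. \<Sum>j\<le>m. k ^ j)"
  proof (rule sum.cong)
    fix m
    show "(\<Sum>j\<le>m. k ^ (m - j)) = (\<Sum>j\<le>m. k ^ j)"
      using sum.nat_diff_reindex[of "\<lambda>j. k ^ j" "Suc m"] by (simp add: lessThan_Suc_atMost)
  qed simp
  also have "\<dots> \<le> (\<Sum>m\<le>r. 2 * k ^ m)" using assms by (intro sum_mono sum_power_le_double)
  also have "\<dots> \<le> 4 * k ^ r" using sum_power_le_double[OF assms(2), of r] by (simp flip: sum_distrib_left)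
  finally show ?thesis .
qed

text \<open>The bound on the lengths of the vertices is an invariant of the induction: it keeps the
  next, longer vertex off the path built so far.\<close>

lemma descendant_path:
  assumes "x \<in> kary_tree k" "set u \<subseteq> {..<k}"
  shows "\<exists>p. tree_path k x (u @ x) p \<and> length p = Suc (length u) \<and> (\<forall>z\<in>set p. length z \<le> length (u @ x))"
  using assms(2)
proof (induction u)
  case Nil
  then show ?case using assms(1) by (intro exI[of _ "[x]"]) (simp add: tree_path_def)
next
  case (Cons i u)
  then obtain p where p: "tree_path k x (u @ x) p" "length p = Suc (length u)"
    "\<forall>z\<in>set p. length z \<le> length (u @ x)" by auto
  have "i # u @ x \<notin> set p" using p(3) by force
  moreover have "i # u @ x \<in> kary_tree k" using Cons.prems assms(1) by (auto simp: kary_tree_def)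
  ultimately have "tree_path k x (i # u @ x) (p @ [i # u @ x])"
    using p(1) by (auto simp: tree_path_def successively_append_iff tree_adj_def)
  then show ?case using p by (intro exI[of _ "p @ [i # u @ x]"]) auto
qed

text \<open>The descendants of \<open>x\<close> exactly \<open>r\<close> generations below already
  lie in the ball.\<close>

lemma card_tree_ball_ge:
  assumes "x \<in> kary_tree k"
  shows "k ^ r \<le> card (tree_ball k x r)"
proof -
  let ?U = "{u. set u \<subseteq> {..<k} \<and> length u = r}"
  have "(\<lambda>u. u @ x) ` ?U \<subseteq> tree_ball k x r"
  proof
    fix y assume "y \<in> (\<lambda>u. u @ x) ` ?U"
    then obtain u where u: "y = u @ x" "set u \<subseteq> {..<k}" "length u = r" by auto
    obtain p where "tree_path k x y p" "length p = Suc r"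
      using descendant_path[OF assms u(2)] u by auto
    then have "tree_dist k x y = r" using tree_dist_eq by force
    moreover have "y \<in> kary_tree k" using u assms by (auto simp: kary_tree_def)
    ultimately show "y \<in> tree_ball k x r" by (simp add: tree_ball_def)
  qed
  then have "card ((\<lambda>u. u @ x) ` ?U) \<le> card (tree_ball k x r)"
    by (intro card_mono finite_tree_ball assms)
  moreover have "card ((\<lambda>u. u @ x) ` ?U) = k ^ r"
    by (subst card_image) (auto simp: inj_on_def card_lists_length_eq)
  ultimately show ?thesis by simp
qed

section \<open>Weighted norms of the maximal function\<close>

lemma sum_le_nn_integral_count_space:
  fixes g :: "'a \<Rightarrow> ennreal"
  assumes "finite F" "F \<subseteq> A"
  shows "sum g F \<le> (\<integral>\<^sup>+x. g x \<partial>count_space A)"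
proof -
  have "sum g F = (\<Sum>x\<in>F. g x * indicator F x)" by (intro sum.cong) auto
  also have "\<dots> = (\<integral>\<^sup>+x. g x * indicator F x \<partial>count_space A)"
    using assms by (intro nn_integral_count_space'[symmetric]) auto
  also have "\<dots> \<le> (\<integral>\<^sup>+x. g x \<partial>count_space A)"
    by (intro nn_integral_mono) (auto simp: indicator_def)
  finally show ?thesis .
qed

lemma nn_integral_count_space_le:
  fixes g :: "'a::countable \<Rightarrow> ennreal"
  assumes "\<And>F. finite F \<Longrightarrow> F \<subseteq> A \<Longrightarrow> sum g F \<le> B"
  shows "(\<integral>\<^sup>+x. g x \<partial>count_space A) \<le> B"
proof -
  define F where "F n = {x \<in> A. to_nat x < n}" for n
  have fin: "finite (F n)" for n
    by (rule finite_subset[of _ "to_nat -` {..<n}"]) (auto simp: F_def intro: finite_vimageI)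
  have "(\<integral>\<^sup>+x. g x \<partial>count_space A) = (\<integral>\<^sup>+x. (SUP n. g x * indicator (F n) x) \<partial>count_space A)"
  proof (rule nn_integral_cong)
    fix x assume "x \<in> space (count_space A)"
    then have "x \<in> F (Suc (to_nat x))" by (simp add: F_def)
    then have "g x \<le> (SUP n. g x * indicator (F n) x)"
      by (intro SUP_upper2[of "Suc (to_nat x)"]) auto
    moreover have "(SUP n. g x * indicator (F n) x) \<le> g x"
      by (intro SUP_least) (auto simp: indicator_def)
    ultimately show "g x = (SUP n. g x * indicator (F n) x)" by (rule antisym)
  qed
  also have "\<dots> = (SUP n. \<integral>\<^sup>+x. g x * indicator (F n) x \<partial>count_space A)"
    by (intro nn_integral_monotone_convergence_SUP)
      (auto simp: incseq_def le_fun_def F_def indicator_def)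
  also have "\<dots> \<le> B"
  proof (rule SUP_least)
    fix n
    have "(\<integral>\<^sup>+x. g x * indicator (F n) x \<partial>count_space A) = (\<Sum>x\<in>F n. g x * indicator (F n) x)"
      using fin by (intro nn_integral_count_space') (auto simp: F_def)
    also have "\<dots> = sum g (F n)" by (intro sum.cong) auto
    also have "\<dots> \<le> B" using fin by (intro assms) (auto simp: F_def)
    finally show "(\<integral>\<^sup>+x. g x * indicator (F n) x \<partial>count_space A) \<le> B" .
  qed
  finally show ?thesis .
qed

lemma enn_powr_ennreal: "0 \<le> c \<Longrightarrow> enn_powr (ennreal c) a = ennreal (c powr a)"
  by (simp add: enn_powr_def)

lemma enn_powr_mono:
  assumes "s \<le> t" "0 < a"
  shows "enn_powr s a \<le> enn_powr t a"
proof (cases "t = \<infinity>")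
  case True
  then show ?thesis by (simp add: enn_powr_def)
next
  case False
  then have "s \<noteq> \<infinity>" using assms by (auto simp: top_unique)
  then show ?thesis
    using assms False
    by (auto simp: enn_powr_def intro!: ennreal_leI powr_mono2 enn2real_mono simp: less_top)
qed

lemma enn_powr_cmult:
  assumes "B > 0"
  shows "enn_powr (ennreal B * t) a = ennreal (B powr a) * enn_powr t a"
proof (cases "t = \<infinity>")
  case True
  then show ?thesis using assms by (simp add: enn_powr_def ennreal_mult_top)
next
  case False
  then obtain u where u: "t = ennreal u" "u \<ge> 0" by (cases t) auto
  then show ?thesis using assms
    by (simp add: enn_powr_ennreal powr_mult flip: ennreal_mult)
qed

lemma Lnorm_le:
  assumes "B > 0" "q > 0"
    and "(\<integral>\<^sup>+x. enn_powr (g x) q * ennreal (v x) \<partial>count_space (kary_tree k))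
      \<le> ennreal B * (\<integral>\<^sup>+x. enn_powr (h x) q * ennreal (v x) \<partial>count_space (kary_tree k))"
  shows "Lnorm k q v g \<le> ennreal (B powr (1 / q)) * Lnorm k q v h"
proof -
  have "Lnorm k q v g \<le> enn_powr (ennreal B *
      (\<integral>\<^sup>+x. enn_powr (h x) q * ennreal (v x) \<partial>count_space (kary_tree k))) (1 / q)"
    unfolding Lnorm_def using assms by (intro enn_powr_mono) auto
  then show ?thesis using assms by (simp add: enn_powr_cmult Lnorm_def)
qed

text \<open>Testing with real values strictly below \<open>g\<close> covers points where
  \<open>g\<close> might be infinite. For the maximal function such a value is exceeded by the
  average over a single ball.\<close>

lemma enn_powr_integral_le:
  fixes V :: "'a::countable set"
  assumes B: "B \<ge> 0" and q: "q > 0" and v: "\<And>x. x \<in> V \<Longrightarrow> v x > 0"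
    and le: "\<And>Y c. finite Y \<Longrightarrow> Y \<subseteq> V \<Longrightarrow> (\<And>y. y \<in> Y \<Longrightarrow> 0 \<le> c y \<and> ennreal (c y) < g y)
      \<Longrightarrow> (\<Sum>y\<in>Y. c y powr q * v y) \<le> B"
  shows "(\<integral>\<^sup>+x. enn_powr (g x) q * ennreal (v x) \<partial>count_space V) \<le> ennreal B"
proof (rule nn_integral_count_space_le)
  fix F assume F: "finite F" "F \<subseteq> V"
  define m where "m x = enn2real (g x)" for x
  have fin: "g x \<noteq> \<infinity>" if x: "x \<in> V" for x
  proof
    assume inf: "g x = \<infinity>"
    \<comment> \<open>If \<open>g\<close> were infinite at \<open>x\<close>, this value alone would
      produce the sum \<open>B + 1\<close>.\<close>
    define c where "c = ((B + 1) / v x) powr (1 / q)"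
    have "(\<Sum>y\<in>{x}. c powr q * v y) \<le> B"
      using x inf by (intro le) (auto simp: c_def)
    moreover have "c powr q * v x = B + 1"
      using v[OF x] B q by (simp add: c_def powr_powr)
    ultimately show False by simp
  qed
  have gm: "g x = ennreal (m x)" if "x \<in> V" for x
    using fin[OF that] by (simp add: m_def less_top)
  have m0: "m x \<ge> 0" for x by (simp add: m_def)
  define F' where "F' = {x \<in> F. m x > 0}"
  have F': "finite F'" "F' \<subseteq> F" using F by (auto simp: F'_def)
  have "(\<Sum>x\<in>F'. m x powr q * v x) \<le> B"
  proof (rule field_le_mult_one_interval)
    \<comment> \<open>Multiplying by \<open>t < 1\<close> gives the strict inequality where
      \<open>m\<close> is positive; the loss is the factor \<open>z = t powr q\<close>, which is
      arbitrarily close to 1.\<close>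
    fix z :: real assume z: "0 < z" "z < 1"
    define t where "t = z powr (1 / q)"
    have t: "0 < t" "t < 1" "t powr q = z"
      using z q powr_less_mono2[of "1 / q" z 1] by (auto simp: t_def powr_powr)
    have "(\<Sum>x\<in>F'. (t * m x) powr q * v x) \<le> B"
    proof (rule le)
      fix y assume "y \<in> F'"
      then have y: "y \<in> V" "m y > 0" using F F' by (auto simp: F'_def)
      then show "0 \<le> t * m y \<and> ennreal (t * m y) < g y"
        using t by (simp add: gm ennreal_less_iff)
    qed (use F F' in auto)
    also have "(\<Sum>x\<in>F'. (t * m x) powr q * v x) = z * (\<Sum>x\<in>F'. m x powr q * v x)"
      using t m0 by (simp add: powr_mult sum_distrib_left mult.assoc)
    finally show "z * (\<Sum>x\<in>F'. m x powr q * v x) \<le> B" .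
  qed
  also have "(\<Sum>x\<in>F'. m x powr q * v x) = (\<Sum>x\<in>F. m x powr q * v x)"
  proof (rule sum.mono_neutral_left)
    show "\<forall>x\<in>F - F'. m x powr q * v x = 0"
      using m0 by (auto simp: F'_def not_less intro: antisym)
  qed (use F F' in auto)
  finally have S: "(\<Sum>x\<in>F. m x powr q * v x) \<le> B" .
  have "(\<Sum>x\<in>F. enn_powr (g x) q * ennreal (v x)) = (\<Sum>x\<in>F. ennreal (m x powr q * v x))"
  proof (rule sum.cong)
    fix x assume "x \<in> F"
    then have x: "x \<in> V" using F by auto
    then show "enn_powr (g x) q * ennreal (v x) = ennreal (m x powr q * v x)"
      using v[OF x] m0[of x] by (simp add: gm enn_powr_ennreal ennreal_mult)
  qed simp
  also have "\<dots> = ennreal (\<Sum>x\<in>F. m x powr q * v x)"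
    using v F by (intro sum_ennreal) (auto simp: less_imp_le subset_iff)
  also have "\<dots> \<le> ennreal B" using S by (rule ennreal_leI)
  finally show "(\<Sum>x\<in>F. enn_powr (g x) q * ennreal (v x)) \<le> ennreal B" .
qed

section \<open>Ball averages, spheres and the kernel on the tree\<close>

lemma tree_sphere_subset_ball:
  "y \<in> kary_tree k \<Longrightarrow> {x \<in> kary_tree k. tree_dist k x y = r} \<subseteq> tree_ball k y r"
  by (auto simp: tree_ball_def tree_dist_sym)

lemma sphere_weight_tree:
  assumes "k \<ge> 2" "tree_weight k w"
  shows "sphere_weight (kary_tree k) (tree_dist k) w (real k)"
proof
  fix y r assume y: "y \<in> kary_tree k"
  show "finite {x \<in> kary_tree k. tree_dist k x y = r}"
    by (rule finite_subset[OF tree_sphere_subset_ball[OF y] finite_tree_ball[OF y]])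
  have "card {x \<in> kary_tree k. tree_dist k x y = r} \<le> card (tree_ball k y r)"
    by (intro card_mono finite_tree_ball tree_sphere_subset_ball y)
  also have "\<dots> \<le> 4 * k ^ r" using y assms by (intro card_tree_ball_le)
  finally have "real (card {x \<in> kary_tree k. tree_dist k x y = r}) \<le> real (4 * k ^ r)"
    by (simp only: of_nat_le_iff)
  then show "real (card {x \<in> kary_tree k. tree_dist k x y = r}) \<le> 4 * real k ^ r" by simp
qed (use assms in \<open>auto simp: tree_weight_def\<close>)

lemma maximal_fun_gtD:
  assumes "ennreal c < maximal_fun k f x" "0 \<le> c"
  shows "\<exists>r. c < (\<Sum>y\<in>tree_ball k x r. cmod (f y)) / real (card (tree_ball k x r))"
  using assms by (auto simp: maximal_fun_def less_SUP_iff ennreal_less_iff)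

text \<open>On the ball of radius \<open>r\<close>, the reciprocal of its cardinality is at most
  \<open>real k powr (- real r)\<close>, hence at most the kernel at any smaller distance.\<close>

lemma ball_average_le_kernel:
  assumes k: "k \<ge> 2" and y: "y \<in> kary_tree k" and X: "finite X" "tree_ball k y r \<subseteq> X"
  shows "(\<Sum>x\<in>tree_ball k y r. cmod (f x)) / real (card (tree_ball k y r))
    \<le> (\<Sum>x\<in>X. real k powr (- real (tree_dist k x y)) * cmod (f x))"
proof -
  have "real k ^ r \<le> real (card (tree_ball k y r))"
    using card_tree_ball_ge[OF y, of r] by (simp flip: of_nat_power)
  then have inv: "1 / real (card (tree_ball k y r)) \<le> real k powr (- real r)"
    using k by (simp add: powr_minus powr_realpow divide_simps)
  have "(\<Sum>x\<in>tree_ball k y r. cmod (f x)) / real (card (tree_ball k y r))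
      = (\<Sum>x\<in>tree_ball k y r. 1 / real (card (tree_ball k y r)) * cmod (f x))"
    by (simp add: sum_divide_distrib)
  also have "\<dots> \<le> (\<Sum>x\<in>tree_ball k y r. real k powr (- real (tree_dist k x y)) * cmod (f x))"
  proof (intro sum_mono mult_right_mono)
    fix x assume "x \<in> tree_ball k y r"
    then have "tree_dist k x y \<le> r" using y by (auto simp: tree_ball_def tree_dist_sym)
    then have "real k powr (- real r) \<le> real k powr (- real (tree_dist k x y))"
      using k by (intro powr_mono) auto
    with inv show "1 / real (card (tree_ball k y r)) \<le> real k powr (- real (tree_dist k x y))"
      by linarith
  qed simp
  also have "\<dots> \<le> (\<Sum>x\<in>X. real k powr (- real (tree_dist k x y)) * cmod (f x))"
    using X by (intro sum_mono2) auto
  finally show ?thesis .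
qed

text \<open>Otherwise summing the sphere bounds over \<open>s \<le> r\<close> would give at most
  \<open>l * k ^ r\<close>, and thus at most \<open>l\<close> times the size of the ball. The
  \<open>1 / 2\<close> absorbs the geometric sum.\<close>

lemma ball_average_gtD:
  assumes k: "k \<ge> 2" and y: "y \<in> kary_tree k" and l: "l \<ge> 0"
    and gt: "l < (\<Sum>x\<in>tree_ball k y r. cmod (f x)) / real (card (tree_ball k y r))"
  shows "\<exists>s. l / 2 * real k ^ s < (\<Sum>x\<in>{x \<in> kary_tree k. tree_dist k x y = s}. cmod (f x))"
proof (rule ccontr)
  assume "\<not> ?thesis"
  then have le: "(\<Sum>x\<in>{x \<in> kary_tree k. tree_dist k x y = s}. cmod (f x)) \<le> l / 2 * real k ^ s" for s
    by (meson not_le)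
  have sphere: "{x \<in> tree_ball k y r. tree_dist k y x = s} = {x \<in> kary_tree k. tree_dist k x y = s}"
    if "s \<le> r" for s
    using that tree_dist_sym[OF y] by (auto simp: tree_ball_def)
  have "(\<Sum>x\<in>tree_ball k y r. cmod (f x))
      = (\<Sum>s\<le>r. \<Sum>x\<in>{x \<in> tree_ball k y r. tree_dist k y x = s}. cmod (f x))"
    by (intro sum.group[symmetric] finite_tree_ball y) (auto simp: tree_ball_def)
  also have "\<dots> = (\<Sum>s\<le>r. \<Sum>x\<in>{x \<in> kary_tree k. tree_dist k x y = s}. cmod (f x))"
    by (rule sum.cong) (simp_all add: sphere)
  also have "\<dots> \<le> (\<Sum>s\<le>r. l / 2 * real k ^ s)" by (intro sum_mono le)
  also have "\<dots> = l / 2 * real (\<Sum>s\<le>r. k ^ s)"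
    by (simp only: sum_distrib_left of_nat_sum of_nat_power)
  also have "\<dots> \<le> l / 2 * real (2 * card (tree_ball k y r))"
  proof (rule mult_left_mono)
    have "(\<Sum>s\<le>r. k ^ s) \<le> 2 * card (tree_ball k y r)"
      using sum_power_le_double[OF k, of r] card_tree_ball_ge[OF y, of r] by linarith
    then show "real (\<Sum>s\<le>r. k ^ s) \<le> real (2 * card (tree_ball k y r))"
      by (simp only: of_nat_le_iff)
  qed (use l in simp)
  finally have "(\<Sum>x\<in>tree_ball k y r. cmod (f x)) \<le> l * real (card (tree_ball k y r))" by simp
  moreover have "card (tree_ball k y r) > 0"
  proof -
    have "0 < k ^ r" using k by simp
    then show ?thesis using card_tree_ball_ge[OF y, of r] by linarith
  qed
  ultimately show False using gt by (simp add: pos_less_divide_eq)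
qed

text \<open>A real number below the maximal function is exceeded by one ball average, and finitely
  many such balls lie in a finite set \<open>X\<close>, on which the kernel sum dominates each of
  these averages.\<close>

lemma maximal_fun_strong_type:
  assumes k: "k \<ge> 2" and q: "q > 0" and B: "B > 0" and v: "\<And>x. x \<in> kary_tree k \<Longrightarrow> v x > 0"
    and fin: "\<And>X Y \<phi>. finite X \<Longrightarrow> X \<subseteq> kary_tree k \<Longrightarrow> finite Y \<Longrightarrow> Y \<subseteq> kary_tree k \<Longrightarrow> (\<And>x. \<phi> x \<ge> 0) \<Longrightarrow>
      (\<Sum>y\<in>Y. (\<Sum>x\<in>X. real k powr (- real (tree_dist k x y)) * \<phi> x) powr q * v y)
        \<le> B * (\<Sum>x\<in>X. \<phi> x powr q * v x)"
  shows "\<exists>C>0. \<forall>f. Lnorm k q v (maximal_fun k f) \<le> ennreal C * Lnorm k q v (\<lambda>x. ennreal (cmod (f x)))"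
proof (intro exI conjI allI)
  show "B powr (1 / q) > 0" using B by simp
  fix f
  define I where "I = (\<integral>\<^sup>+x. enn_powr (ennreal (cmod (f x))) q * ennreal (v x) \<partial>count_space (kary_tree k))"
  have "(\<integral>\<^sup>+x. enn_powr (maximal_fun k f x) q * ennreal (v x) \<partial>count_space (kary_tree k)) \<le> ennreal B * I"
  \<comment> \<open>When \<open>I\<close> is infinite so is the right side, because
    \<open>B > 0\<close>.\<close>
  proof (cases I)
    case top
    then show ?thesis using B by (simp add: ennreal_mult_top)
  next
    case (real i)
    have "(\<integral>\<^sup>+x. enn_powr (maximal_fun k f x) q * ennreal (v x) \<partial>count_space (kary_tree k)) \<le> ennreal (B * i)"
    proof (rule enn_powr_integral_le[OF _ q v])
      fix Y c assume Y: "finite Y" "Y \<subseteq> kary_tree k"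
        and c: "\<And>y. y \<in> Y \<Longrightarrow> 0 \<le> c y \<and> ennreal (c y) < maximal_fun k f y"
      have "\<forall>y\<in>Y. \<exists>r. c y < (\<Sum>x\<in>tree_ball k y r. cmod (f x)) / real (card (tree_ball k y r))"
        using c maximal_fun_gtD by blast
      then obtain r where r: "\<And>y. y \<in> Y \<Longrightarrow>
          c y < (\<Sum>x\<in>tree_ball k y (r y). cmod (f x)) / real (card (tree_ball k y (r y)))"
        by metis
      define X where "X = (\<Union>y\<in>Y. tree_ball k y (r y))"
      have X: "finite X" "X \<subseteq> kary_tree k"
        using Y finite_tree_ball by (auto simp: X_def tree_ball_def)
      have "c y \<le> (\<Sum>x\<in>X. real k powr (- real (tree_dist k x y)) * cmod (f x))" if "y \<in> Y" for y
      proof -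
        have "(\<Sum>x\<in>tree_ball k y (r y). cmod (f x)) / real (card (tree_ball k y (r y)))
            \<le> (\<Sum>x\<in>X. real k powr (- real (tree_dist k x y)) * cmod (f x))"
          using that Y X by (intro ball_average_le_kernel k) (auto simp: X_def)
        with r[OF that] show ?thesis by linarith
      qed
      then have "(\<Sum>y\<in>Y. c y powr q * v y)
          \<le> (\<Sum>y\<in>Y. (\<Sum>x\<in>X. real k powr (- real (tree_dist k x y)) * cmod (f x)) powr q * v y)"
        using c q by (intro sum_mono mult_right_mono powr_mono2 less_imp_le[OF v] subsetD[OF Y(2)]) auto
      also have "\<dots> \<le> B * (\<Sum>x\<in>X. cmod (f x) powr q * v x)"
        using X Y by (intro fin) auto
      also have "(\<Sum>x\<in>X. cmod (f x) powr q * v x) \<le> i"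
      proof -
        have "ennreal (\<Sum>x\<in>X. cmod (f x) powr q * v x) = (\<Sum>x\<in>X. enn_powr (ennreal (cmod (f x))) q * ennreal (v x))"
          using X v by (subst sum_ennreal[symmetric])
            (auto simp: enn_powr_ennreal ennreal_mult less_imp_le subset_iff intro!: sum.cong)
        also have "\<dots> \<le> I" unfolding I_def using X by (rule sum_le_nn_integral_count_space)
        finally show ?thesis using real by simp
      qed
      finally show "(\<Sum>y\<in>Y. c y powr q * v y) \<le> B * i" using B by simp
    qed (use B real in auto)
    then show ?thesis using B real by (simp add: ennreal_mult)
  qed
  then show "Lnorm k q v (maximal_fun k f) \<le> ennreal (B powr (1 / q)) * Lnorm k q v (\<lambda>x. ennreal (cmod (f x)))"
    unfolding I_def by (rule Lnorm_le[OF B q])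
qed

text \<open>Scaling \<open>f\<close> by \<open>2 / l\<close> turns level \<open>l\<close> of the
  ball averages into level 1 of the sphere sums; the 2 is the loss in
  \<open>ball_average_gtD\<close>.\<close>

lemma maximal_fun_weak_type:
  assumes k: "k \<ge> 2" and q: "q > 0" and D: "D > 0" and w: "\<And>x. x \<in> kary_tree k \<Longrightarrow> w x > 0"
    and fin: "\<And>\<phi> H X \<rho>. finite H \<Longrightarrow> H \<subseteq> kary_tree k \<Longrightarrow> finite X \<Longrightarrow> X \<subseteq> kary_tree k \<Longrightarrow>
      (\<And>y. y \<in> H \<Longrightarrow> {x \<in> kary_tree k. tree_dist k x y = \<rho> y} \<subseteq> X) \<Longrightarrow>
      (\<And>y. y \<in> H \<Longrightarrow> real k ^ \<rho> y < (\<Sum>x\<in>{x \<in> kary_tree k. tree_dist k x y = \<rho> y}. \<phi> x)) \<Longrightarrow>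
      sum w H \<le> D * (\<Sum>x\<in>X. \<bar>\<phi> x\<bar> powr q * w x)"
  shows "\<exists>C>0. \<forall>f. weak_Lnorm k q w (maximal_fun k f) \<le> ennreal C * Lnorm k q w (\<lambda>x. ennreal (cmod (f x)))"
proof (intro exI conjI allI)
  show "2 * D powr (1 / q) > 0" using D by simp
  fix f
  define I where "I = (\<integral>\<^sup>+x. enn_powr (ennreal (cmod (f x))) q * ennreal (w x) \<partial>count_space (kary_tree k))"
  have level: "ennreal l * enn_powr (weight_of w {x \<in> kary_tree k. maximal_fun k f x > ennreal l}) (1 / q)
      \<le> ennreal (2 * D powr (1 / q)) * enn_powr I (1 / q)" if l: "l > 0" for l
  proof -
    define B where "B = D * (2 / l) powr q"
    have B: "B > 0" using D l by (simp add: B_def)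
    have "weight_of w {x \<in> kary_tree k. maximal_fun k f x > ennreal l} \<le> ennreal B * I"
      unfolding weight_of_def
    proof (rule nn_integral_count_space_le)
      fix H assume H: "finite H" "H \<subseteq> {x \<in> kary_tree k. maximal_fun k f x > ennreal l}"
      have "\<exists>s. l / 2 * real k ^ s < (\<Sum>x\<in>{x \<in> kary_tree k. tree_dist k x y = s}. cmod (f x))" if "y \<in> H" for y
      proof -
        have y: "y \<in> kary_tree k" "ennreal l < maximal_fun k f y" using that H by auto
        obtain r where "l < (\<Sum>x\<in>tree_ball k y r. cmod (f x)) / real (card (tree_ball k y r))"
          using maximal_fun_gtD[OF y(2)] l by auto
        then show ?thesis using l by (intro ball_average_gtD[OF k y(1)]) auto
      qed
      then obtain \<rho> where \<rho>: "\<And>y. y \<in> H \<Longrightarrow>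
          l / 2 * real k ^ \<rho> y < (\<Sum>x\<in>{x \<in> kary_tree k. tree_dist k x y = \<rho> y}. cmod (f x))"
        by metis
      define X where "X = (\<Union>y\<in>H. tree_ball k y (\<rho> y))"
      have X: "finite X" "X \<subseteq> kary_tree k"
        using H finite_tree_ball by (auto simp: X_def tree_ball_def)
      have "sum w H \<le> D * (\<Sum>x\<in>X. \<bar>2 / l * cmod (f x)\<bar> powr q * w x)"
      proof (rule fin)
        show "{x \<in> kary_tree k. tree_dist k x y = \<rho> y} \<subseteq> X" if "y \<in> H" for y
          using that H tree_sphere_subset_ball[of y k "\<rho> y"] by (auto simp: X_def)
        show "real k ^ \<rho> y < (\<Sum>x\<in>{x \<in> kary_tree k. tree_dist k x y = \<rho> y}. 2 / l * cmod (f x))" if "y \<in> H" for y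
          using \<rho>[OF that] l unfolding sum_distrib_left[symmetric] by (simp add: field_simps)
      qed (use H X in auto)
      also have "\<dots> = B * (\<Sum>x\<in>X. cmod (f x) powr q * w x)"
        unfolding B_def sum_distrib_left
        using l by (intro sum.cong refl) (simp add: abs_mult powr_mult powr_divide)
      finally have le: "sum w H \<le> B * (\<Sum>x\<in>X. cmod (f x) powr q * w x)" .
      have "(\<Sum>x\<in>H. ennreal (w x)) = ennreal (sum w H)"
        using H w by (intro sum_ennreal) (auto simp: less_imp_le subset_iff)
      also have "\<dots> \<le> ennreal (B * (\<Sum>x\<in>X. cmod (f x) powr q * w x))" using le by (rule ennreal_leI)
      also have "\<dots> = ennreal B * ennreal (\<Sum>x\<in>X. cmod (f x) powr q * w x)"
        using B by (intro ennreal_mult') auto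
      also have "ennreal (\<Sum>x\<in>X. cmod (f x) powr q * w x) = (\<Sum>x\<in>X. enn_powr (ennreal (cmod (f x))) q * ennreal (w x))"
        using X w by (subst sum_ennreal[symmetric])
          (auto simp: enn_powr_ennreal ennreal_mult less_imp_le subset_iff intro!: sum.cong)
      also have "ennreal B * \<dots> \<le> ennreal B * I"
        unfolding I_def using X by (intro mult_left_mono sum_le_nn_integral_count_space) auto
      finally show "(\<Sum>x\<in>H. ennreal (w x)) \<le> ennreal B * I" .
    qed
    then have "enn_powr (weight_of w {x \<in> kary_tree k. maximal_fun k f x > ennreal l}) (1 / q)
        \<le> ennreal (B powr (1 / q)) * enn_powr I (1 / q)"
      using enn_powr_mono[of _ "ennreal B * I" "1 / q"] q B by (simp add: enn_powr_cmult)
    then have "ennreal l * enn_powr (weight_of w {x \<in> kary_tree k. maximal_fun k f x > ennreal l}) (1 / q)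
        \<le> ennreal l * (ennreal (B powr (1 / q)) * enn_powr I (1 / q))"
      by (intro mult_left_mono) auto
    also have "\<dots> = ennreal (l * B powr (1 / q)) * enn_powr I (1 / q)"
      using l by (simp add: ennreal_mult mult.assoc)
    \<comment> \<open>The level cancels, which makes the constant uniform in
      \<open>l\<close>.\<close>
    also have "l * B powr (1 / q) = 2 * D powr (1 / q)"
      using l D q by (simp add: B_def powr_mult powr_powr)
    finally show ?thesis .
  qed
  show "weak_Lnorm k q w (maximal_fun k f)
      \<le> ennreal (2 * D powr (1 / q)) * Lnorm k q w (\<lambda>x. ennreal (cmod (f x)))"
    unfolding weak_Lnorm_def Lnorm_def I_def[symmetric] using level by (intro SUP_least) auto
qed

theorem theorem1p1:
  fixes k :: nat and p \<alpha> \<beta> :: real and w :: "nat list \<Rightarrow> real"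
  assumes "k \<ge> 2" and "p > 1" and "tree_weight k w"
    and "0 < \<beta>" and "\<beta> < 1" and "\<beta> \<le> \<alpha>" and "\<alpha> < p"
    and "\<exists>C::real. \<forall>E F. \<forall>r::nat.
           finite E \<and> E \<subseteq> kary_tree k \<and> finite F \<and> F \<subseteq> kary_tree k \<longrightarrow>
           (\<Sum>x\<in>E. \<Sum>y\<in>{y \<in> F. tree_dist k x y = r}. w y)
             \<le> C * real k powr (real r * \<beta>) * (\<Sum>x\<in>E. w x) powr (\<alpha> / p) * (\<Sum>y\<in>F. w y) powr (1 - \<alpha> / p)"
  shows "(\<exists>C::real. C > 0 \<and> (\<forall>f :: nat list \<Rightarrow> complex.
           weak_Lnorm k (\<beta> / \<alpha> * p) w (maximal_fun k f)
             \<le> ennreal C * Lnorm k (\<beta> / \<alpha> * p) w (\<lambda>x. ennreal (cmod (f x)))))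
    \<and> (\<beta> < \<alpha> \<longrightarrow> (\<exists>C::real. C > 0 \<and> (\<forall>f :: nat list \<Rightarrow> complex.
           Lnorm k p w (maximal_fun k f) \<le> ennreal C * Lnorm k p w (\<lambda>x. ennreal (cmod (f x)))))
      \<and> (\<exists>C::real. C > 0 \<and> (\<forall>f :: nat list \<Rightarrow> complex.
           Lnorm k (p / (p - 1)) (dual_weight p w) (maximal_fun k f)
             \<le> ennreal C * Lnorm k (p / (p - 1)) (dual_weight p w) (\<lambda>x. ennreal (cmod (f x))))))"
proof -
  interpret sphere_weight "kary_tree k" "tree_dist k" w "real k"
    using assms by (intro sphere_weight_tree)
  from assms(8) obtain C0 where "sphere_estimate (\<alpha> / p) \<beta> C0"
    unfolding sphere_estimate_def sphere_sum_def by blast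
  \<comment> \<open>The hypothesis supplies an arbitrary real constant; it is enlarged to a positive
    one.\<close>
  then have est: "sphere_estimate (\<alpha> / p) \<beta> (max C0 1)"
    by (rule sphere_estimate_mono) auto
  have a: "0 < \<alpha> / p" "\<alpha> / p < 1" and \<alpha>: "\<alpha> > 0" using assms by auto
  have q: "\<beta> / (\<alpha> / p) = \<beta> / \<alpha> * p" by simp
  have C: "0 < max C0 1" by simp
  from weak_type_unit[OF est C a(1) assms(4,5)]
  obtain D where D: "D > 0" and weak: "\<forall>f H X \<rho>. finite H \<and> H \<subseteq> kary_tree k \<and> finite X \<and> X \<subseteq> kary_tree k \<and>
      (\<forall>y\<in>H. {x \<in> kary_tree k. tree_dist k x y = \<rho> y} \<subseteq> X \<and>
        real k ^ \<rho> y < (\<Sum>x\<in>{x \<in> kary_tree k. tree_dist k x y = \<rho> y}. f x)) \<longrightarrow>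
      sum w H \<le> D * (\<Sum>x\<in>X. \<bar>f x\<bar> powr (\<beta> / (\<alpha> / p)) * w x)"
    by (elim exE conjE)
  have "\<exists>C>0. \<forall>f. weak_Lnorm k (\<beta> / \<alpha> * p) w (maximal_fun k f)
      \<le> ennreal C * Lnorm k (\<beta> / \<alpha> * p) w (\<lambda>x. ennreal (cmod (f x)))"
  proof (rule maximal_fun_weak_type[OF assms(1) _ D w_pos])
    show "0 < \<beta> / \<alpha> * p" using assms \<alpha> by simp
    fix \<phi> H X \<rho>
    assume "finite H" "H \<subseteq> kary_tree k" "finite X" "X \<subseteq> kary_tree k"
      "\<And>y. y \<in> H \<Longrightarrow> {x \<in> kary_tree k. tree_dist k x y = \<rho> y} \<subseteq> X"
      "\<And>y. y \<in> H \<Longrightarrow> real k ^ \<rho> y < (\<Sum>x\<in>{x \<in> kary_tree k. tree_dist k x y = \<rho> y}. \<phi> x)"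
    then show "sum w H \<le> D * (\<Sum>x\<in>X. \<bar>\<phi> x\<bar> powr (\<beta> / \<alpha> * p) * w x)"
      unfolding q[symmetric] by (intro weak[rule_format, of H X \<rho> \<phi>]) simp
  qed
  moreover have "(\<exists>C>0. \<forall>f. Lnorm k p w (maximal_fun k f) \<le> ennreal C * Lnorm k p w (\<lambda>x. ennreal (cmod (f x))))
      \<and> (\<exists>C>0. \<forall>f. Lnorm k (p / (p - 1)) (dual_weight p w) (maximal_fun k f)
             \<le> ennreal C * Lnorm k (p / (p - 1)) (dual_weight p w) (\<lambda>x. ennreal (cmod (f x))))"
    if "\<beta> < \<alpha>"
  proof -
    \<comment> \<open>This puts \<open>\<beta> < \<alpha>\<close> into the form that leaves room for
      exponents above \<open>1 / p\<close>.\<close>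
    have "\<beta> < \<alpha> / p * p" using that assms by simp
    from sphere_estimate_neighbourhood[OF est C a assms(4,5) assms(2) this] obtain \<delta> b C where \<delta>: "0 < \<delta>" "\<delta> \<le> 1 / p" "1 / p + \<delta> \<le> 1" "b < 1" "C > 0"
        "sphere_estimate (1 / p + \<delta>) b C" "sphere_estimate (1 / p - \<delta>) b C"
      by (elim exE conjE)
    then obtain D where D: "D > 0" and kb: "kernel_bounded p D"
      using kernel_bilinear_bound[of p \<delta> b C] assms(2) by blast
    show ?thesis
    proof
      show "\<exists>C>0. \<forall>f. Lnorm k p w (maximal_fun k f) \<le> ennreal C * Lnorm k p w (\<lambda>x. ennreal (cmod (f x)))"
      proof (rule maximal_fun_strong_type[OF assms(1) _ _ w_pos])
        show "0 < (2 * D) powr p" using D by simp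
        show "(\<Sum>y\<in>Y. (\<Sum>x\<in>X. real k powr - real (tree_dist k x y) * \<phi> x) powr p * w y)
            \<le> (2 * D) powr p * (\<Sum>x\<in>X. \<phi> x powr p * w x)"
          if "finite X" "X \<subseteq> kary_tree k" "finite Y" "Y \<subseteq> kary_tree k" "\<And>x. 0 \<le> \<phi> x" for X Y \<phi>
          using kernel_strong_type[OF kb D assms(2) that] by (simp add: kernel_sum_def)
      qed (use assms in auto)
      show "\<exists>C>0. \<forall>f. Lnorm k (p / (p - 1)) (dual_weight p w) (maximal_fun k f)
             \<le> ennreal C * Lnorm k (p / (p - 1)) (dual_weight p w) (\<lambda>x. ennreal (cmod (f x)))"
      proof (rule maximal_fun_strong_type[OF assms(1)])
        show "0 < (2 * D) powr (p / (p - 1))" using D by simp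
        show "0 < dual_weight p w x" if "x \<in> kary_tree k" for x
          using w_pos[OF that] by (simp add: dual_weight_def)
        show "(\<Sum>y\<in>Y. (\<Sum>x\<in>X. real k powr - real (tree_dist k x y) * \<phi> x) powr (p / (p - 1)) * dual_weight p w y)
            \<le> (2 * D) powr (p / (p - 1)) * (\<Sum>x\<in>X. \<phi> x powr (p / (p - 1)) * dual_weight p w x)"
          if "finite X" "X \<subseteq> kary_tree k" "finite Y" "Y \<subseteq> kary_tree k" "\<And>x. 0 \<le> \<phi> x" for X Y \<phi>
          using kernel_strong_type_dual[OF kb D assms(2) tree_dist_sym that]
          by (simp add: kernel_sum_def dual_weight_def)
      qed (use assms in auto)
    qed
  qed
  ultimately show ?thesis by blast
qed

end
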